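(* Let $\mathcal{G}_{3,6}=\mathrm{conv}(SO(6)\cdot e_1\wedge e_2\wedge e_3)\subset\wedge_3\mathbb{R}^6$ be the Grassmann orbitope and let $\mathcal{G}_{3,6}^\circ$ be its polar body (the Grassmann coorbitope). Then $\mathcal{G}_{3,6}^\circ$ has extreme points that are not exposed, and $\mathcal{G}_{3,6}$ has edges that are not exposed. Neither $\mathcal{G}_{3,6}$ nor $\mathcal{G}_{3,6}^\circ$ is a spectrahedron.
   Context: $\mathcal{G}_{3,6}$ is the convex hull in $\wedge_3\mathbb{R}^6\simeq\mathbb{R}^{20}$ of all $u_1\wedge u_2\wedge u_3$ with $u_1,u_2,u_3$ orthonormal in $\mathbb{R}^6$. The polar body of $K\subset V$ is $K^\circ=\{\ell\in V^*:\ell(x)\le1\text{ for all }x\in K\}$. A face of a convex body $K$ is a closed convex subset containing the two endpoints of every open segment in $K$ that it intersects; an extreme point is a zero-dimensional face and an edge is a one-dimensional face. A face is exposed if it is the set of maximizers over $K$ of some linear functional. A spectrahedron is a set of the form $\{x\in\mathbb{R}^N:A_0+x_1A_1+\cdots+x_NA_N\succeq0\}$ with $A_i$ real symmetric matrices. *)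

theory Defs
  imports "HOL-Analysis.Analysis"
begin

section \<open>The exterior power $\wedge_3\mathbb{R}^6$ in Pluecker coordinates\<close>

text \<open>
  The coordinates on $\wedge_3\mathbb{R}^6$ with respect to the basis
  $e_i \wedge e_j \wedge e_k$ are indexed by the 20 triples $i < j < k$.
  The numeral type \<^typ>\<open>6\<close> is ordered as $0 < 1 < \cdots < 5$, and \<open>6 = 0\<close> in it, so
  the sixth basis vector is listed first; this only affects the labelling and signs of coordinates.
\<close>

typedef triple = "{(i :: 6, j :: 6, k :: 6). i < j \<and> j < k}"
proof -
  have "(0 :: 6) < 1 \<and> (1 :: 6) < 2"
    by (simp add: less_bit0_def bit0.Rep_0 bit0.Rep_1 bit0.Rep_numeral)
  then show ?thesis
    by blast
qed

instance triple :: finite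
proof
  have "finite (Rep_triple ` UNIV)"
    by (rule finite_subset[of _ UNIV]) auto
  then show "finite (UNIV :: triple set)"
    by (rule finite_imageD) (simp add: Rep_triple_inject inj_on_def)
qed

lemma card_triple: "CARD(triple) = 20"
proof -
  let ?T = "{(i :: 6, j :: 6, k :: 6). i < j \<and> j < k}"
  let ?Z = "{(i, j, k) \<in> {0..<6 :: int} \<times> {0..<6 :: int} \<times> {0..<6 :: int}. i < j \<and> j < k}"
  have "Rep_bit0 i \<in> {0..<6}" for i :: 6
    using Rep_bit0[of i] by simp
  then have "bij_betw (\<lambda>(i, j, k). (Rep_bit0 i, Rep_bit0 j, Rep_bit0 k)) ?T ?Z"
    by (intro bij_betw_byWitness[where f' = "\<lambda>(i, j, k). (Abs_bit0 i, Abs_bit0 j, Abs_bit0 k)"])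
       (auto simp: less_bit0_def Rep_bit0_inverse Abs_bit0_inverse)
  then have "card ?T = card ?Z"
    by (rule bij_betw_same_card)
  also have "card ?Z = 20"
    by code_simp
  finally show ?thesis
    by (simp add: type_definition.card[OF type_definition_triple])
qed

definition wedge3 :: "real ^ 6 \<Rightarrow> real ^ 6 \<Rightarrow> real ^ 6 \<Rightarrow> real ^ triple"
  where "wedge3 u v w = (\<chi> I. case Rep_triple I of (i, j, k) \<Rightarrow>
    det (vector [vector [u $ i, u $ j, u $ k],
                 vector [v $ i, v $ j, v $ k],
                 vector [w $ i, w $ j, w $ k]] :: real ^ 3 ^ 3))"


section \<open>The Grassmann orbitope and polar bodies\<close>

text \<open>A matrix $A \in SO(6)$ acts by
  $A \cdot (e_1 \wedge e_2 \wedge e_3) = Ae_1 \wedge Ae_2 \wedge Ae_3$.\<close>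

definition grassmann_orbitope :: "(real ^ triple) set"
  where "grassmann_orbitope = convex hull
    {wedge3 (A *v axis 1 1) (A *v axis 2 1) (A *v axis 3 1) | A. rotation_matrix A}"

lemma grassmann_orbitope_orthonormal:
  "grassmann_orbitope = convex hull
    {wedge3 u v w | u v w. norm u = 1 \<and> norm v = 1 \<and> norm w = 1 \<and>
       u \<bullet> v = 0 \<and> u \<bullet> w = 0 \<and> v \<bullet> w = 0}"
proof -
  have "{wedge3 (A *v axis 1 1) (A *v axis 2 1) (A *v axis 3 1) | A. rotation_matrix A} =
    {wedge3 u v w | u v w. norm u = 1 \<and> norm v = 1 \<and> norm w = 1 \<and>
       u \<bullet> v = 0 \<and> u \<bullet> w = 0 \<and> v \<bullet> w = 0}" (is "?L = ?R")
  proof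
    show "?L \<subseteq> ?R"
    proof
      fix x
      assume "x \<in> ?L"
      then obtain A :: "real ^ 6 ^ 6" where A: "rotation_matrix A"
        and x: "x = wedge3 (A *v axis 1 1) (A *v axis 2 1) (A *v axis 3 1)"
        by blast
      have *: "norm (A *v axis i 1) = 1" for i
        using A by (simp add: rotation_matrix_def orthogonal_matrix_orthonormal_columns
            matrix_vector_mul_component matrix_vector_mult_basis)
      have **: "(A *v axis i 1) \<bullet> (A *v axis j 1) = 0" if "i \<noteq> j" for i j
        using A that by (simp add: rotation_matrix_def orthogonal_matrix_orthonormal_columns
            matrix_vector_mult_basis orthogonal_def)
      have "(1 :: 6) \<noteq> 2" "(1 :: 6) \<noteq> 3" "(2 :: 6) \<noteq> 3"
        by simp_all
      then show "x \<in> ?R"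
        unfolding x mem_Collect_eq
        by (intro exI[of _ "A *v axis 1 1"] exI[of _ "A *v axis 2 1"] exI[of _ "A *v axis 3 1"]
            conjI refl * **)
    qed
    show "?R \<subseteq> ?L"
    proof
      fix x
      assume "x \<in> ?R"
      then obtain u v w :: "real ^ 6" where x: "x = wedge3 u v w"
        and n: "norm u = 1" "norm v = 1" "norm w = 1"
        and o: "u \<bullet> v = 0" "u \<bullet> w = 0" "v \<bullet> w = 0"
        by blast
      obtain U where U: "U \<inter> insert 0 {u, v, w} = {}"
          "pairwise orthogonal ({u, v, w} \<union> U)"
          "span ({u, v, w} \<union> U) = span ({u, v, w} \<union> UNIV)"
        using o by (rule_tac orthogonal_extension_strong[of "{u, v, w}" UNIV])
          (auto simp: pairwise_def orthogonal_def inner_commute)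
      define B where "B = {u, v, w} \<union> U"
      have d: "u \<noteq> v" "u \<noteq> w" "v \<noteq> w"
        using n o by auto
      have n0: "0 \<notin> B"
        using n U(1) by (auto simp: B_def)
      then have ind: "independent B"
        using U(2) pairwise_orthogonal_independent unfolding B_def by blast
      have sp: "span B = UNIV"
        using U(3) by (simp add: B_def)
      have cB: "card B = 6"
        using dim_eq_card_independent[OF ind] dim_span[of B] unfolding sp by simp
      have fB: "finite B"
        using ind by (rule independent_imp_finite)
      have "card (B - {u, v, w}) = 3"
        using cB fB d card_Diff_subset[of "{u, v, w}" B] by (simp add: B_def)
      moreover have "card (UNIV - {1, 2, 3 :: 6}) = 3"
        using card_Diff_subset[of "{1, 2, 3 :: 6}" UNIV] by simp
      ultimately have "card (B - {u, v, w}) = card (UNIV - {1, 2, 3 :: 6})"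
        by simp
      then obtain f where f: "bij_betw f (UNIV - {1, 2, 3 :: 6}) (B - {u, v, w})"
        using finite_same_card_bij fB by (metis finite finite_Diff)
      have fB': "f i \<in> B \<and> f i \<noteq> u \<and> f i \<noteq> v \<and> f i \<noteq> w" if "i \<noteq> 1" "i \<noteq> 2" "i \<noteq> 3" for i
        using f that bij_betwE by blast
      have finj: "i = j" if "f i = f j" "i \<noteq> 1" "i \<noteq> 2" "i \<noteq> 3" "j \<noteq> 1" "j \<noteq> 2" "j \<noteq> 3" for i j
        using f that unfolding bij_betw_def inj_on_def by blast
      define g where "g i = (if i = 1 then u else if i = 2 then v else if i = 3 then w
        else f i /\<^sub>R norm (f i))" for i :: 6
      define g' where "g' i = (if i = 1 then u else if i = 2 then v else if i = 3 then w
        else f i)" for i :: 6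
      have g': "g' i \<in> B" for i
        using fB' by (auto simp: g'_def B_def)
      have inj: "g' i \<noteq> g' j" if "i \<noteq> j" for i j
      proof
        assume "g' i = g' j"
        then have "i = j"
          using d fB'[of i] fB'[of j] finj[of i j] unfolding g'_def
          by (simp split: if_splits)
        with that show False
          by simp
      qed
      have g'n: "g i = g' i /\<^sub>R norm (g' i)" for i
        using n by (auto simp: g'_def g_def)
      have g1: "norm (g i) = 1" for i
        using g'[of i] n0 unfolding g'n by (metis norm_sgn sgn_div_norm)
      have g2: "orthogonal (g i) (g j)" if "i \<noteq> j" for i j
        using g'[of i] g'[of j] inj[OF that] U(2)[folded B_def]
        unfolding g'n by (auto simp: pairwise_def orthogonal_clauses)
      define M :: "real \<Rightarrow> real ^ 6 ^ 6"
        where "M c = (\<chi> i. if i = 4 then c *\<^sub>R g i else g i)" for c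
      have orth: "orthogonal_matrix (M c)" if "\<bar>c\<bar> = 1" for c
        using g1 g2 that unfolding orthogonal_matrix_orthonormal_rows
        by (auto simp: M_def row_def orthogonal_clauses)
      have det: "det (M c) = c * det (M 1)" for c
        unfolding M_def
        by (subst det_row_mul[of 4 c g g, unfolded scalar_mult_eq_scaleR])
           (auto intro!: arg_cong[where f = det] simp: vec_eq_iff)
      have "\<bar>det (M 1)\<bar> = 1"
        using orth[of 1] det_orthogonal_matrix by fastforce
      then have rot: "rotation_matrix (transpose (M (det (M 1))))"
        unfolding rotation_matrix_def using orth[of "det (M 1)"] det[of "det (M 1)"]
        by (auto simp: orthogonal_matrix_transpose abs_if split: if_splits)
      have "transpose (M c) *v axis i 1 = g i" if "i \<noteq> 4" for i c
        using that by (simp add: matrix_vector_mult_basis M_def column_transpose row_def)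
      then have "x = wedge3 (transpose (M (det (M 1))) *v axis 1 1)
          (transpose (M (det (M 1))) *v axis 2 1) (transpose (M (det (M 1))) *v axis 3 1)"
        by (simp add: x g_def)
      then show "x \<in> ?L"
        using rot by blast
    qed
  qed
  then show ?thesis
    by (simp add: grassmann_orbitope_def)
qed

text \<open>
  A linear functional $\ell$ on $\mathbb{R}^N$ is represented by its coordinate vector
  with respect to the dual basis, so that $\ell(x)$ becomes \<open>y \<bullet> x\<close>.
\<close>

definition polar :: "(real ^ 'n) set \<Rightarrow> (real ^ 'n) set"
  where "polar K = {y. \<forall>x\<in>K. y \<bullet> x \<le> 1}"

lemma linear_functional_unique_vector:
  fixes f :: "real ^ 'n \<Rightarrow> real"
  shows "linear f \<longleftrightarrow> (\<exists>!y. f = (\<lambda>x. y \<bullet> x))"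
proof
  assume f: "linear f"
  have "f x = adjoint f 1 \<bullet> x" for x
    using adjoint_works[OF f, of x 1] by (simp add: inner_commute)
  then have "f = (\<lambda>x. adjoint f 1 \<bullet> x)"
    by blast
  moreover have "y = z" if "\<forall>x. y \<bullet> x = z \<bullet> x" for y z :: "real ^ 'n"
    using that by (metis vector_eq_rdot)
  ultimately show "\<exists>!y. f = (\<lambda>x. y \<bullet> x)"
    by metis
next
  assume "\<exists>!y. f = (\<lambda>x. y \<bullet> x)"
  then show "linear f"
    by (auto intro: bounded_linear.linear bounded_linear_inner_right)
qed

text \<open>For nonempty faces, the library's exposed faces are those consisting of the
  maximizers of a linear functional.\<close>

lemma exposed_face_of_iff_maximizers:
  fixes K T :: "(real ^ 'n) set"
  assumes "T \<noteq> {}"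
  shows "T exposed_face_of K \<longleftrightarrow>
    T face_of K \<and> (\<exists>f :: real ^ 'n \<Rightarrow> real. linear f \<and> T = {x \<in> K. \<forall>y\<in>K. f y \<le> f x})"
proof
  assume "T exposed_face_of K"
  then obtain a b where T: "T face_of K" "K \<subseteq> {x. a \<bullet> x \<le> b}" "T = K \<inter> {x. a \<bullet> x = b}"
    unfolding exposed_face_of_def by blast
  obtain t where "t \<in> K" "a \<bullet> t = b"
    using assms T(3) by blast
  then have "T = {x \<in> K. \<forall>y\<in>K. a \<bullet> y \<le> a \<bullet> x}"
    using T(2,3) by force
  then show "T face_of K \<and> (\<exists>f :: real ^ 'n \<Rightarrow> real. linear f \<and> T = {x \<in> K. \<forall>y\<in>K. f y \<le> f x})"
    using T(1) bounded_linear.linear[OF bounded_linear_inner_right[of a]]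
    by (auto intro!: exI[of _ "(\<bullet>) a"])
next
  assume "T face_of K \<and> (\<exists>f :: real ^ 'n \<Rightarrow> real. linear f \<and> T = {x \<in> K. \<forall>y\<in>K. f y \<le> f x})"
  then obtain f :: "real ^ 'n \<Rightarrow> real"
    where T: "T face_of K" "T = {x \<in> K. \<forall>y\<in>K. f y \<le> f x}" and "linear f"
    by blast
  then obtain a where f: "f = (\<lambda>x. a \<bullet> x)"
    using linear_functional_unique_vector[of f] by blast
  obtain t where "t \<in> T"
    using assms by blast
  then have "K \<subseteq> {x. a \<bullet> x \<le> a \<bullet> t}" "T = K \<inter> {x. a \<bullet> x = a \<bullet> t}"
    using T(2) f by fastforce+
  then show "T exposed_face_of K"
    using T(1) unfolding exposed_face_of_def by blast
qed


section \<open>Spectrahedra\<close>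

text \<open>An \<open>m \<times> m\<close> matrix is a function on index pairs, of which only the entries with
  both indices below \<open>m\<close> matter; the size \<open>m\<close> is not bound to the ambient dimension.\<close>

definition symmetric_mat :: "nat \<Rightarrow> (nat \<Rightarrow> nat \<Rightarrow> real) \<Rightarrow> bool"
  where "symmetric_mat m M \<longleftrightarrow> (\<forall>r<m. \<forall>c<m. M r c = M c r)"

definition psd_mat :: "nat \<Rightarrow> (nat \<Rightarrow> nat \<Rightarrow> real) \<Rightarrow> bool"
  where "psd_mat m M \<longleftrightarrow> (\<forall>v :: nat \<Rightarrow> real. 0 \<le> (\<Sum>r<m. \<Sum>c<m. v r * M r c * v c))"

definition spectrahedron :: "(real ^ 'n) set \<Rightarrow> bool"
  where "spectrahedron S \<longleftrightarrow>
    (\<exists>m A0 (A :: 'n \<Rightarrow> nat \<Rightarrow> nat \<Rightarrow> real).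
       symmetric_mat m A0 \<and> (\<forall>i. symmetric_mat m (A i)) \<and>
       S = {x. psd_mat m (\<lambda>r c. A0 r c + (\<Sum>i\<in>UNIV. x $ i * A i r c))})"

end

theory Submission
  imports Defs
begin

text \<open>
  Write $e_1, e_2, e_3$ and $f_1, f_2, f_3$ for the basis vectors with indices 0, 1, 2 and 3, 4, 5.
  A trivector then splits into four blocks: a number \<open>a = eee x\<close>, two $3 \times 3$ matrices
  \<open>M = eef x\<close> and \<open>N = eff x\<close>, and a number \<open>d = fff x\<close>.
  The only facts about decomposable unit trivectors needed to bound the forms below are
  $a^2 + |M|^2 + |N|^2 + d^2 = 1$ and the two traced Pluecker relations
  \<open>a * trace N = minors2 M\<close> and \<open>d * trace M = minors2 N\<close>, where \<open>minors2\<close> is the sum of the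
  principal $2 \times 2$ minors (\<open>grassmannian_norm\<close>, \<open>grassmannian_pluecker\<close>).

  One extreme point of the polar body that is not exposed is the form \<open>a + trace N / 2\<close>. By the Pluecker
  relation its square is at most $a^2 + |M|^2 + \frac34 |N|^2 \le 1$, and the value 1 is taken only at
  $p = e_1 \wedge e_2 \wedge e_3$. Hence a functional exposing this form would have to be a multiple
  of $p$; but $p$, read as a form, lies in the polar body too and also takes the value 1 at $p$. So
  the form is not exposed (\<open>degenerate_form_not_exposed\<close>). It is nevertheless extreme, because its
  maximum at $p$ is degenerate: on the graph of the matrix \<open>s * identity + s^2 * X\<close> it falls short
  of the maximum only by a quantity of order $s^4$, whatever \<open>X\<close> is. A perturbation \<open>h\<close> that may be
  added and subtracted has to vanish to that order along all these curves of planes, and this kills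
  every block of \<open>h\<close> (\<open>degenerate_form_rigid\<close>).

  The edge constructed here lies in the face of special Lagrangian planes, where the form
  \<open>a - trace N\<close> = $\mathrm{Re}(dz_1 \wedge dz_2 \wedge dz_3)$ equals 1. On that face the matrices
  \<open>M\<close> and \<open>N\<close> are symmetric, and this forces $a \ge -\frac18$ with equality exactly at the two planes
  obtained from $p$ by rotating every pair $(e_j, f_j)$ by $\pm 2\pi/3$. Being a face of a face,
  the segment between them is an edge (\<open>sl_edge_edge_of\<close>). Along the circle of planes obtained by
  rotating by a common angle $t$, any functional is a combination of $\cos 3t$, $\sin 3t$, $\cos t$,
  $\sin t$. If it attains its maximum over the orbitope at both $t = \pm 2\pi/3$, then the values and
  derivatives at these two angles leave only a multiple of $\cos 3t$, so that it is also maximal at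
  $t = 0$, that is at $p$, which is not on the edge (\<open>sl_edge_not_exposed\<close>).

  Finally, all faces of a spectrahedron are exposed (\<open>spectrahedron_face_exposed\<close>), so neither body
  is a spectrahedron.
\<close>

section \<open>Block coordinates on trivectors\<close>

lemma UNIV_6: "UNIV = {0, 1, 2, 3, 4, 5 :: 6}"
proof -
  have "card {0, 1, 2, 3, 4, 5 :: 6} = CARD(6)" by simp
  then show ?thesis
    by (metis card_subset_eq finite_class.finite_UNIV subset_UNIV)
qed

lemma less_6:
  "(0::6) < 1" "(1::6) < 2" "(2::6) < 3" "(3::6) < 4" "(4::6) < 5" "(0::6) < 2" "(0::6) < 3" "(0::6) < 4" "(0::6) < 5" 
  "(1::6) < 3" "(1::6) < 4" "(1::6) < 5" "(2::6) < 4" "(2::6) < 5" "(3::6) < 5"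
  by (simp_all add: less_bit0_def bit0.Rep_0 bit0.Rep_1 bit0.Rep_numeral)

definition coord :: "real ^ triple \<Rightarrow> 6 \<Rightarrow> 6 \<Rightarrow> 6 \<Rightarrow> real"
  where "coord x i j k = x $ Abs_triple (i, j, k)"

lemma coord_wedge3:
  assumes "i < j" "j < k"
  shows "coord (wedge3 u v w) i j k =
    u $ i * (v $ j * w $ k - v $ k * w $ j) - u $ j * (v $ i * w $ k - v $ k * w $ i)
    + u $ k * (v $ i * w $ j - v $ j * w $ i)"
  using assms by (simp add: coord_def wedge3_def Abs_triple_inverse det_3 vector_3 algebra_simps)

definition ascending_triples :: "(6 \<times> 6 \<times> 6) set" where
  "ascending_triples = {(0,1,2), (0,1,3), (0,1,4), (0,1,5), (0,2,3), (0,2,4), (0,2,5),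
     (0,3,4), (0,3,5), (0,4,5), (1,2,3), (1,2,4), (1,2,5), (1,3,4), (1,3,5), (1,4,5),
     (2,3,4), (2,3,5), (2,4,5), (3,4,5)}"

lemma sum_triple: "(\<Sum>I\<in>UNIV. f I) = (\<Sum>t\<in>ascending_triples. f (Abs_triple t))"
proof -
  have T: "ascending_triples \<subseteq> {(i, j, k). i < j \<and> j < k}"
    unfolding ascending_triples_def by (simp only: insert_subset empty_subsetI mem_Collect_eq split less_6 simp_thms)
  have inj: "inj_on Abs_triple ascending_triples"
    by (rule inj_on_subset[OF _ T]) (auto simp: inj_on_def Abs_triple_inject)
  have "card ascending_triples = 20"
    by (simp add: ascending_triples_def)
  then have "card (Abs_triple ` ascending_triples) = CARD(triple)"
    by (simp add: card_image[OF inj] card_triple)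
  then have "Abs_triple ` ascending_triples = UNIV"
    by (intro card_subset_eq) auto
  then show ?thesis
    using sum.reindex[OF inj, of f] by (simp add: o_def)
qed

lemma inner_3_3: "A \<bullet> B = A$1$1 * B$1$1 + A$1$2 * B$1$2 + A$1$3 * B$1$3
   + A$2$1 * B$2$1 + A$2$2 * B$2$2 + A$2$3 * B$2$3
   + A$3$1 * B$3$1 + A$3$2 * B$3$2 + A$3$3 * B$3$3" for A B :: "real^3^3"
  by (simp add: inner_vec_def sum_3)

lemma trace_3: "trace A = A$1$1 + A$2$2 + A$3$3" for A :: "real^3^3"
  by (simp add: trace_def sum_3)

lemma trace_mat_3: "trace (mat t :: real^3^3) = 3 * t"
  by (simp add: trace_3 mat_def)

lemma inner_mat_3: "A \<bullet> mat t = t * trace A" for A :: "real^3^3"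
  by (simp add: inner_3_3 mat_def trace_3 algebra_simps)

text \<open>
  In the two matrix blocks the column is the slot of the product that is altered. The entry of
  \<open>eef x\<close> in row $k$ and column $j$ is the coefficient of $e_1 \wedge e_2 \wedge e_3$ with its $j$-th
  factor replaced by $f_k$; the entry of \<open>eff x\<close> is the coefficient of
  $f_1 \wedge f_2 \wedge f_3$ with its $j$-th factor replaced by $e_k$. The signs come from sorting the factors.
\<close>

definition eee :: "real ^ triple \<Rightarrow> real" where "eee x = coord x 0 1 2"

definition eef :: "real ^ triple \<Rightarrow> real ^ 3 ^ 3" where
  "eef x = vector [vector [coord x 1 2 3, - coord x 0 2 3, coord x 0 1 3],
                   vector [coord x 1 2 4, - coord x 0 2 4, coord x 0 1 4],
                   vector [coord x 1 2 5, - coord x 0 2 5, coord x 0 1 5]]"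

definition eff :: "real ^ triple \<Rightarrow> real ^ 3 ^ 3" where
  "eff x = vector [vector [coord x 0 4 5, - coord x 0 3 5, coord x 0 3 4],
                   vector [coord x 1 4 5, - coord x 1 3 5, coord x 1 3 4],
                   vector [coord x 2 4 5, - coord x 2 3 5, coord x 2 3 4]]"

definition fff :: "real ^ triple \<Rightarrow> real" where "fff x = coord x 3 4 5"

lemma inner_blocks:
  "x \<bullet> y = eee x * eee y + eef x \<bullet> eef y + eff x \<bullet> eff y + fff x * fff y"
  by (simp add: inner_vec_def[of x y] sum_triple ascending_triples_def inner_3_3 eee_def eef_def eff_def fff_def coord_def vector_3)

lemma blocks_eqI:
  assumes "eee x = eee y" "eef x = eef y" "eff x = eff y" "fff x = fff y"
  shows "x = y"
proof -
  have "z \<bullet> x = z \<bullet> y" for z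
    by (simp add: inner_blocks assms)
  then show ?thesis
    by (metis vector_eq_ldot)
qed

section \<open>Norm and Pluecker relations of decomposable trivectors\<close>

text \<open>
  The second elementary symmetric function of the eigenvalues.
\<close>

definition minors2 :: "real^3^3 \<Rightarrow> real" where
 "minors2 A = A$1$1 * A$2$2 - A$1$2 * A$2$1 + A$1$1 * A$3$3 - A$1$3 * A$3$1 + A$2$2 * A$3$3 - A$2$3 * A$3$2"

lemma pluecker_eee: "x = wedge3 u v w \<Longrightarrow> eee x * trace (eff x) = minors2 (eef x)"
  by (simp add: minors2_def trace_3 eee_def eef_def eff_def fff_def vector_3 coord_wedge3 less_6 algebra_simps)

lemma pluecker_fff: "x = wedge3 u v w \<Longrightarrow> fff x * trace (eef x) = minors2 (eff x)"
  by (simp add: minors2_def trace_3 eee_def eef_def eff_def fff_def vector_3 coord_wedge3 less_6 algebra_simps)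

definition ascending_pairs :: "(6 \<times> 6) set" where
  "ascending_pairs = {(0,1), (0,2), (0,3), (0,4), (0,5), (1,2), (1,3), (1,4), (1,5),
     (2,3), (2,4), (2,5), (3,4), (3,5), (4,5)}"

lemma sum_6: "(\<Sum>i\<in>UNIV. f i) = f 0 + f 1 + f 2 + f 3 + f 4 + f 5" for f :: "6 \<Rightarrow> real"
  unfolding UNIV_6 by simp

lemma inner_6: "u \<bullet> v = u$0 * v$0 + u$1 * v$1 + u$2 * v$2 + u$3 * v$3 + u$4 * v$4 + u$5 * v$5"
  for u v :: "real^6"
  unfolding inner_vec_def sum_6 by simp

text \<open>
  Lagrange's identity for the coordinates of $v \wedge w$.
\<close>

lemma lagrange_pairs: "(\<Sum>(i,j)\<in>ascending_pairs. (v$i * w$j - v$j * w$i)\<^sup>2) = (v \<bullet> v) * (w \<bullet> w) - (v \<bullet> w)\<^sup>2"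
  for v w :: "real^6"
  by (simp add: ascending_pairs_def inner_6 power2_eq_square algebra_simps)

text \<open>
  The coordinates of $u \wedge p$ for a bivector $p$: wedging with $u$ and contracting with $u$
  add up to multiplication of the squared norm by $|u|^2$. The contraction term drops out for
  $p = v \wedge w$ with $v, w$ orthogonal to $u$, which gives the norm of an orthogonal product
  below without expanding a Gram determinant.
\<close>

lemma lagrange_triples:
  fixes u :: "real ^ 6" and p :: "6 \<Rightarrow> 6 \<Rightarrow> real"
  assumes anti: "\<And>i j. p j i = - p i j"
  shows "(\<Sum>(i,j,k)\<in>ascending_triples. (u$i * p j k - u$j * p i k + u$k * p i j)\<^sup>2) =
    (u \<bullet> u) * (\<Sum>(i,j)\<in>ascending_pairs. (p i j)\<^sup>2) - (\<Sum>k\<in>UNIV. (\<Sum>j\<in>UNIV. u$j * p j k)\<^sup>2)"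
proof -
  have d: "p i i = 0" for i
    using anti[of i i] by simp
  have a: "p j i = - p i j" if "i < j" for i j
    by (rule anti)
  show ?thesis
    by (simp add: ascending_triples_def ascending_pairs_def inner_6 sum_6 d a less_6 power2_eq_square algebra_simps)
qed

lemma wedge3_inner_self:
  assumes "u \<bullet> v = 0" "u \<bullet> w = 0" "v \<bullet> w = 0"
  shows "wedge3 u v w \<bullet> wedge3 u v w = (u \<bullet> u) * (v \<bullet> v) * (w \<bullet> w)"
proof -
  define p where "p i j = v$i * w$j - v$j * w$i" for i j
  have "(\<Sum>j\<in>UNIV. u$j * p j k) = (u \<bullet> v) * w$k - v$k * (u \<bullet> w)" for k
    by (simp add: p_def inner_6 sum_6 algebra_simps)
  then have c: "(\<Sum>j\<in>UNIV. u$j * p j k) = 0" for k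
    using assms by simp
  have "wedge3 u v w \<bullet> wedge3 u v w = (\<Sum>(i,j,k)\<in>ascending_triples. (u$i * p j k - u$j * p i k + u$k * p i j)\<^sup>2)"
    unfolding inner_vec_def[of "wedge3 u v w"] sum_triple inner_real_def coord_def[symmetric]
    by (simp add: ascending_triples_def p_def coord_wedge3[unfolded coord_def] less_6 power2_eq_square)
  also have "\<dots> = (u \<bullet> u) * (\<Sum>(i,j)\<in>ascending_pairs. (p i j)\<^sup>2)"
    by (subst lagrange_triples) (simp_all add: p_def c[unfolded p_def])
  also have "(\<Sum>(i,j)\<in>ascending_pairs. (p i j)\<^sup>2) = (v \<bullet> v) * (w \<bullet> w)"
    unfolding p_def lagrange_pairs by (simp add: assms)
  finally show ?thesis by simp
qed

lemma wedge3_scale: "wedge3 (a *\<^sub>R u) (b *\<^sub>R v) (c *\<^sub>R w) = (a * b * c) *\<^sub>R wedge3 u v w"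
  by (simp add: wedge3_def vec_eq_iff det_3 vector_3 split: prod.split) (simp add: algebra_simps)

lemma wedge3_shear: "wedge3 u (v + a *\<^sub>R u) (w + b *\<^sub>R u + c *\<^sub>R v) = wedge3 u v w"
  by (simp add: wedge3_def vec_eq_iff det_3 vector_3 split: prod.split) (simp add: algebra_simps)

section \<open>Inequalities for three-by-three matrices\<close>

lemma trace_power2_le: "(trace A)\<^sup>2 \<le> 3 * (A \<bullet> A)" for A :: "real^3^3"
proof -
  have "3 * (A \<bullet> A) - (trace A)\<^sup>2 = (A$1$1 - A$2$2)\<^sup>2 + (A$1$1 - A$3$3)\<^sup>2 + (A$2$2 - A$3$3)\<^sup>2
    + 3 * ((A$1$2)\<^sup>2 + (A$1$3)\<^sup>2 + (A$2$1)\<^sup>2 + (A$2$3)\<^sup>2 + (A$3$1)\<^sup>2 + (A$3$2)\<^sup>2)"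
    by (simp add: inner_3_3 trace_3 power2_eq_square algebra_simps)
  also have "\<dots> \<ge> 0" by simp
  finally show ?thesis by simp
qed

lemma trace_power2_eqD:
  fixes A :: "real^3^3"
  assumes "(trace A)\<^sup>2 = 3 * (A \<bullet> A)"
  shows "A = mat (trace A / 3)"
proof -
  have "(A$1$1 - A$2$2)\<^sup>2 + (A$1$1 - A$3$3)\<^sup>2 + (A$2$2 - A$3$3)\<^sup>2
    + 3 * ((A$1$2)\<^sup>2 + (A$1$3)\<^sup>2 + (A$2$1)\<^sup>2 + (A$2$3)\<^sup>2 + (A$3$1)\<^sup>2 + (A$3$2)\<^sup>2) = 
    3 * (A \<bullet> A) - (trace A)\<^sup>2"
    by (simp add: inner_3_3 trace_3 power2_eq_square algebra_simps)
  also have "\<dots> = 0" using assms by simp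
  finally have "A$1$1 = A$2$2 \<and> A$1$1 = A$3$3 \<and> A$1$2 = 0 \<and> A$1$3 = 0 \<and> A$2$1 = 0 \<and> A$2$3 = 0 \<and> A$3$1 = 0 \<and> A$3$2 = 0"
    by (simp add: add_nonneg_eq_0_iff)
  then show ?thesis
    by (simp add: vec_eq_iff forall_3 mat_def trace_3)
qed

text \<open>
  Equality holds for all scalar matrices; this is what makes the maximum of the form
  \<open>degenerate_form\<close> below degenerate.
\<close>

lemma minors2_le: "minors2 A \<le> A \<bullet> A"
proof -
  have "2 * (A \<bullet> A - minors2 A) = (A$1$1 - A$2$2)\<^sup>2 + (A$1$1 - A$3$3)\<^sup>2 + (A$2$2 - A$3$3)\<^sup>2
    + (A$1$2 + A$2$1)\<^sup>2 + (A$1$3 + A$3$1)\<^sup>2 + (A$2$3 + A$3$2)\<^sup>2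
    + (A$1$2)\<^sup>2 + (A$1$3)\<^sup>2 + (A$2$1)\<^sup>2 + (A$2$3)\<^sup>2 + (A$3$1)\<^sup>2 + (A$3$2)\<^sup>2"
    by (simp add: inner_3_3 minors2_def power2_eq_square algebra_simps)
  also have "\<dots> \<ge> 0" by simp
  finally show ?thesis by simp
qed

text \<open>
  The last bracket measures the failure of symmetry. For symmetric matrices the identity expresses
  \<open>minors2 A\<close> through the norm and the trace.
\<close>

lemma minors2_trace: "(trace A)\<^sup>2 = A \<bullet> A + 2 * minors2 A
    - ((A$1$2 - A$2$1)\<^sup>2 + (A$1$3 - A$3$1)\<^sup>2 + (A$2$3 - A$3$2)\<^sup>2)" for A :: "real^3^3"
  by (simp add: inner_3_3 trace_3 minors2_def power2_eq_square algebra_simps)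

section \<open>The orbitope and its polar body\<close>

definition grassmannian :: "(real ^ triple) set"
  where "grassmannian = {wedge3 u v w | u v w. norm u = 1 \<and> norm v = 1 \<and> norm w = 1 \<and>
       u \<bullet> v = 0 \<and> u \<bullet> w = 0 \<and> v \<bullet> w = 0}"

lemma grassmannianI:
  assumes "norm u = 1" "norm v = 1" "norm w = 1" "u \<bullet> v = 0" "u \<bullet> w = 0" "v \<bullet> w = 0"
  shows "wedge3 u v w \<in> grassmannian"
  using assms unfolding grassmannian_def by blast

lemma grassmann_orbitope_hull: "grassmann_orbitope = convex hull grassmannian"
  by (simp add: grassmann_orbitope_orthonormal grassmannian_def)

lemma grassmannian_pluecker:
  assumes "x \<in> grassmannian"
  shows "eee x * trace (eff x) = minors2 (eef x)" "fff x * trace (eef x) = minors2 (eff x)"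
  using assms pluecker_eee pluecker_fff unfolding grassmannian_def by blast+

lemma grassmannian_norm:
  assumes "x \<in> grassmannian"
  shows "norm x = 1" "(eee x)\<^sup>2 + eef x \<bullet> eef x + eff x \<bullet> eff x + (fff x)\<^sup>2 = 1"
proof -
  obtain u v w where x: "x = wedge3 u v w" and n: "norm u = 1" "norm v = 1" "norm w = 1"
    and o: "u \<bullet> v = 0" "u \<bullet> w = 0" "v \<bullet> w = 0"
    using assms unfolding grassmannian_def by blast
  have "x \<bullet> x = 1"
    unfolding x wedge3_inner_self[OF o] using n by (simp add: dot_square_norm)
  then show "norm x = 1" "(eee x)\<^sup>2 + eef x \<bullet> eef x + eff x \<bullet> eff x + (fff x)\<^sup>2 = 1"
    by (simp_all add: norm_eq_1 inner_blocks power2_eq_square)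
qed

lemma grassmannian_uminus: "x \<in> grassmannian \<Longrightarrow> - x \<in> grassmannian"
proof -
  assume "x \<in> grassmannian"
  then obtain u v w where x: "x = wedge3 u v w" and n: "norm u = 1" "norm v = 1" "norm w = 1"
    and o: "u \<bullet> v = 0" "u \<bullet> w = 0" "v \<bullet> w = 0"
    unfolding grassmannian_def by blast
  have "- x = wedge3 (- u) v w"
    using wedge3_scale[of "- 1" u 1 v 1 w] by (simp add: x)
  then show ?thesis
    using n o by (simp add: grassmannianI)
qed

lemma compact_grassmannian: "compact grassmannian"
proof -
  define T :: "((real ^ 6) \<times> (real ^ 6) \<times> (real ^ 6)) set"
    where "T = {(u, v, w). norm u = 1 \<and> norm v = 1 \<and> norm w = 1 \<and> u \<bullet> v = 0 \<and> u \<bullet> w = 0 \<and> v \<bullet> w = 0}"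
  have "T = (sphere 0 1 \<times> sphere 0 1 \<times> sphere 0 1) \<inter>
    {t. fst t \<bullet> fst (snd t) = 0 \<and> fst t \<bullet> snd (snd t) = 0 \<and> fst (snd t) \<bullet> snd (snd t) = 0}"
    by (auto simp: T_def)
  moreover have "closed {t :: (real ^ 6) \<times> (real ^ 6) \<times> (real ^ 6). fst t \<bullet> fst (snd t) = 0 \<and> fst t \<bullet> snd (snd t) = 0 \<and> fst (snd t) \<bullet> snd (snd t) = 0}"
    by (intro closed_Collect_conj closed_Collect_eq continuous_intros)
  ultimately have "compact T"
    by (simp add: compact_Times compact_Int_closed)
  moreover have "continuous_on T (\<lambda>t. wedge3 (fst t) (fst (snd t)) (snd (snd t)))"
    unfolding wedge3_def
  proof (rule continuous_on_vec_lambda)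
    fix I
    obtain i j k where I: "Rep_triple I = (i, j, k)"
      by (cases "Rep_triple I") auto
    show "continuous_on T (\<lambda>t. case Rep_triple I of (i, j, k) \<Rightarrow>
      det (vector [vector [fst t $ i, fst t $ j, fst t $ k], 
        vector [fst (snd t) $ i, fst (snd t) $ j, fst (snd t) $ k],
        vector [snd (snd t) $ i, snd (snd t) $ j, snd (snd t) $ k]] :: real^3^3))"
      unfolding I split det_3 vector_3 by (intro continuous_intros)
  qed
  ultimately have "compact ((\<lambda>t. wedge3 (fst t) (fst (snd t)) (snd (snd t))) ` T)"
    by (intro compact_continuous_image)
  also have "(\<lambda>t. wedge3 (fst t) (fst (snd t)) (snd (snd t))) ` T = grassmannian"
    unfolding T_def grassmannian_def by force
  finally show ?thesis .
qed

lemma compact_orbitope: "compact grassmann_orbitope" and convex_orbitope: "convex grassmann_orbitope"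
  by (simp_all add: grassmann_orbitope_hull compact_convex_hull compact_grassmannian)

lemma grassmannian_subset_orbitope: "grassmannian \<subseteq> grassmann_orbitope"
  by (simp add: grassmann_orbitope_hull hull_subset)

lemma orbitope_leI:
  assumes "x \<in> grassmann_orbitope" "\<And>g. g \<in> grassmannian \<Longrightarrow> y \<bullet> g \<le> b"
  shows "y \<bullet> x \<le> b"
proof -
  have "grassmann_orbitope \<subseteq> {x. y \<bullet> x \<le> b}"
    unfolding grassmann_orbitope_hull using assms(2) by (intro hull_minimal) (auto simp: convex_halfspace_le)
  with assms(1) show ?thesis by blast
qed

lemma polar_orbitope: "y \<in> polar grassmann_orbitope \<longleftrightarrow> (\<forall>g\<in>grassmannian. y \<bullet> g \<le> 1)"
  unfolding polar_def using orbitope_leI grassmannian_subset_orbitope by blast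

lemma convex_polar: "convex (polar K)"
proof -
  have "polar K = (\<Inter>x\<in>K. {y. x \<bullet> y \<le> 1})"
    by (auto simp: polar_def inner_commute)
  then show ?thesis by (simp add: convex_INT convex_halfspace_le)
qed

text \<open>
  By Gram--Schmidt every decomposable trivector is a nonnegative multiple of one in the Grassmannian.
  This allows test planes to be given by arbitrary, not necessarily orthonormal, bases.
\<close>

lemma polar_wedge3_le:
  assumes y: "y \<in> polar grassmann_orbitope"
  shows "y \<bullet> wedge3 u v w \<le> norm (wedge3 u v w)"
proof -
  have orth: "y \<bullet> wedge3 u v w \<le> norm (wedge3 u v w)" if o: "u \<bullet> v = 0" "u \<bullet> w = 0" "v \<bullet> w = 0" for u v w
  proof (cases "u = 0 \<or> v = 0 \<or> w = 0")
    case True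
    then have "wedge3 u v w \<bullet> wedge3 u v w = 0"
      using wedge3_inner_self[OF o] by auto
    then show ?thesis by simp
  next
    case False
    define r where "r = norm u * norm v * norm w"
    have r: "r \<ge> 0" by (simp add: r_def)
    have g: "wedge3 (u /\<^sub>R norm u) (v /\<^sub>R norm v) (w /\<^sub>R norm w) \<in> grassmannian" (is "?g \<in> _")
      using False o by (intro grassmannianI) simp_all
    have "r * (inverse (norm u) * inverse (norm v) * inverse (norm w)) = 1"
      using False by (simp add: r_def field_simps)
    then have w: "wedge3 u v w = r *\<^sub>R ?g"
      by (simp add: wedge3_scale)
    show ?thesis
      using mult_left_mono[OF _ r, of "y \<bullet> ?g" 1] y g r grassmannian_norm(1)[OF g]
      unfolding w by (simp add: polar_orbitope)
  qed
  \<comment> \<open>Gram--Schmidt on possibly dependent vectors: if \<open>u\<close> or \<open>v'\<close> is 0, division by 0 gives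
    the coefficient 0, and orthogonality to the zero vector is trivial.\<close>
  define a where "a = - (u \<bullet> v) / (u \<bullet> u)"
  define v' where "v' = v + a *\<^sub>R u"
  define c where "c = - (v' \<bullet> w) / (v' \<bullet> v')"
  define b where "b = - (u \<bullet> w) / (u \<bullet> u)"
  define w' where "w' = w + (b + c * a) *\<^sub>R u + c *\<^sub>R v"
  have w': "w' = w + b *\<^sub>R u + c *\<^sub>R v'"
    by (simp add: w'_def v'_def algebra_simps)
  have uv: "u \<bullet> v' = 0"
    by (cases "u = 0") (simp_all add: v'_def a_def inner_add_right inner_diff_right)
  have "u \<bullet> w' = 0"
    by (cases "u = 0") (simp_all add: w' b_def inner_add_right inner_diff_right uv)
  moreover have "v' \<bullet> w' = 0"
    using uv by (cases "v' = 0") (simp_all add: w' c_def inner_add_right inner_diff_right inner_commute)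
  ultimately show ?thesis
    using orth[OF uv, of w'] wedge3_shear[of u v a w "b + c * a" c]
    by (simp only: v'_def[symmetric] w'_def[symmetric])
qed

text \<open>
  The bipolar theorem for the orbitope, which contains the origin because it is symmetric.
\<close>

lemma bipolar_orbitope:
  assumes "\<And>y. y \<in> polar grassmann_orbitope \<Longrightarrow> a \<bullet> y \<le> 1"
  shows "a \<in> grassmann_orbitope"
proof (rule ccontr)
  assume "a \<notin> grassmann_orbitope"
  then obtain c b where c: "c \<bullet> a < b" "\<forall>x\<in>grassmann_orbitope. b < c \<bullet> x"
    using separating_hyperplane_closed_point[OF convex_orbitope compact_imp_closed[OF compact_orbitope]] by blast
  define g where "g = wedge3 (axis 0 1) (axis 1 1) (axis 2 1)"
  have "g \<in> grassmannian"
    unfolding g_def by (intro grassmannianI) (simp_all add: inner_axis_axis)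
  then have "b < c \<bullet> g" "b < c \<bullet> (- g)"
    using c(2) grassmannian_uminus grassmannian_subset_orbitope by blast+
  then have b: "b < 0" by simp
  have "c /\<^sub>R b \<in> polar grassmann_orbitope"
    unfolding polar_orbitope
  proof
    fix g assume "g \<in> grassmannian"
    then have "b < c \<bullet> g" using c(2) grassmannian_subset_orbitope by blast
    then show "(c /\<^sub>R b) \<bullet> g \<le> 1" using b by (simp add: field_simps)
  qed
  then have "a \<bullet> (c /\<^sub>R b) \<le> 1" by (rule assms)
  then show False using b c(1) by (simp add: field_simps inner_commute)
qed

lemma convex_hull_Int_supporting_hyperplane:
  fixes S :: "'a :: euclidean_space set"
  assumes "compact S" "\<And>x. x \<in> S \<Longrightarrow> a \<bullet> x \<le> b"
  shows "convex hull S \<inter> {x. a \<bullet> x = b} = convex hull (S \<inter> {x. a \<bullet> x = b})"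
proof
  \<comment> \<open>Every face of a convex hull is spanned by some of the generators.\<close>
  have "convex hull S \<subseteq> {x. a \<bullet> x \<le> b}"
    using assms(2) by (intro hull_minimal) (auto simp: convex_halfspace_le)
  then have "convex hull S \<inter> {x. a \<bullet> x = b} face_of convex hull S"
    by (intro face_of_Int_supporting_hyperplane_le) auto
  then obtain T where T: "T \<subseteq> S" "convex hull S \<inter> {x. a \<bullet> x = b} = convex hull T"
    using face_of_convex_hull_subset[OF assms(1)] by metis
  have "T \<subseteq> {x. a \<bullet> x = b}"
    using hull_subset[of T convex] T(2) by blast
  then show "convex hull S \<inter> {x. a \<bullet> x = b} \<subseteq> convex hull (S \<inter> {x. a \<bullet> x = b})"
    unfolding T(2) using T(1) by (intro hull_mono) blast
  show "convex hull (S \<inter> {x. a \<bullet> x = b}) \<subseteq> convex hull S \<inter> {x. a \<bullet> x = b}"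
    by (intro hull_minimal Int_mono hull_subset) (auto simp: convex_Int convex_hyperplane)
qed

section \<open>Planes as graphs of matrices\<close>

text \<open>
  The adjugate matrix.
\<close>

definition adj3 :: "real^3^3 \<Rightarrow> real^3^3" where
  "adj3 A = vector [
    vector [A$2$2 * A$3$3 - A$2$3 * A$3$2, A$1$3 * A$3$2 - A$1$2 * A$3$3, A$1$2 * A$2$3 - A$1$3 * A$2$2],
    vector [A$2$3 * A$3$1 - A$2$1 * A$3$3, A$1$1 * A$3$3 - A$1$3 * A$3$1, A$1$3 * A$2$1 - A$1$1 * A$2$3],
    vector [A$2$1 * A$3$2 - A$2$2 * A$3$1, A$1$2 * A$3$1 - A$1$1 * A$3$2, A$1$1 * A$2$2 - A$1$2 * A$2$1]]"

lemma trace_adj3: "trace (adj3 A) = minors2 A"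
  by (simp add: trace_3 adj3_def vector_3 minors2_def algebra_simps)

text \<open>
  \<open>graph3 c A\<close> is the product over \<open>j\<close> of the vectors \<open>c e\<^sub>j + A f\<^sub>j\<close>, where \<open>A f\<^sub>j\<close> stands for the
  combination of $f_1, f_2, f_3$ with coefficients from the \<open>j\<close>-th column of \<open>A\<close>. For $c = 1$
  this is the plane that is the graph of \<open>A\<close>; for \<open>c = cos t\<close> and \<open>A = mat (sin t)\<close> it is
  $e_1 \wedge e_2 \wedge e_3$ with every pair $(e_j, f_j)$ rotated by the angle \<open>t\<close>.
\<close>

definition graph_vec :: "real \<Rightarrow> real^3^3 \<Rightarrow> 3 \<Rightarrow> 6 \<Rightarrow> real^6" where
  "graph_vec c A j i = axis i c + axis 3 (A$1$j) + axis 4 (A$2$j) + axis 5 (A$3$j)"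

definition graph3 :: "real \<Rightarrow> real^3^3 \<Rightarrow> real^triple" where
  "graph3 c A = wedge3 (graph_vec c A 1 0) (graph_vec c A 2 1) (graph_vec c A 3 2)"

lemma graph3_blocks:
  "eee (graph3 c A) = c ^ 3" "eef (graph3 c A) = c\<^sup>2 *\<^sub>R A"
  "eff (graph3 c A) = c *\<^sub>R adj3 A" "fff (graph3 c A) = det A"
  by (simp_all add: vec_eq_iff forall_3 eee_def eef_def eff_def fff_def vector_3 graph3_def coord_wedge3 less_6
      graph_vec_def axis_def adj3_def det_3 power2_eq_square power3_eq_cube algebra_simps)

lemma graph3_grassmannian:
  assumes "c\<^sup>2 + s\<^sup>2 = 1"
  shows "graph3 c (mat s) \<in> grassmannian"
  unfolding graph3_def using assms
  by (intro grassmannianI) (simp_all add: norm_eq_1 inner_6 graph_vec_def axis_def mat_def power2_eq_square)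

lemma graph3_mat_blocks:
  "eee (graph3 c (mat s)) = c ^ 3" "eef (graph3 c (mat s)) = mat (c\<^sup>2 * s)"
  "eff (graph3 c (mat s)) = mat (c * s\<^sup>2)" "fff (graph3 c (mat s)) = s ^ 3"
  by (simp_all add: graph3_blocks vec_eq_iff forall_3 adj3_def det_3 mat_def vector_3 power2_eq_square power3_eq_cube)

lemma inner_graph3_mat: "y \<bullet> graph3 c (mat s) =
    eee y * c ^ 3 + trace (eef y) * c\<^sup>2 * s + trace (eff y) * c * s\<^sup>2 + fff y * s ^ 3"
  by (simp add: inner_blocks[of y] graph3_mat_blocks inner_mat_3 algebra_simps)

definition e123 :: "real ^ triple" where "e123 = graph3 1 (mat 0)"

lemma e123_blocks: "eee e123 = 1" "eef e123 = 0" "eff e123 = 0" "fff e123 = 0"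
  by (simp_all add: e123_def graph3_blocks adj3_def det_3 mat_def vec_eq_iff forall_3 vector_3)

lemma e123_inner: "e123 \<bullet> x = eee x"
  by (simp add: inner_blocks[of e123] e123_blocks)

lemma e123_grassmannian: "e123 \<in> grassmannian"
  unfolding e123_def by (rule graph3_grassmannian) simp

section \<open>An extreme point of the polar body that is not exposed\<close>

text \<open>
  The form with blocks $a = 1$, $M = 0$, $N = \frac12 \cdot \mathrm{identity}$, $d = 0$.
\<close>

definition degenerate_form :: "real ^ triple" where
  "degenerate_form = axis (Abs_triple (0, 1, 2)) 1 + (1/2) *\<^sub>R (axis (Abs_triple (0,4,5)) 1
    - axis (Abs_triple (1,3,5)) 1 + axis (Abs_triple (2,3,4)) 1)"

lemma degenerate_form_inner: "degenerate_form \<bullet> x = eee x + trace (eff x) / 2"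
  by (simp add: degenerate_form_def inner_axis' inner_left_distrib inner_diff_left eee_def eff_def trace_3 vector_3 coord_def)

text \<open>
  The Pluecker relation turns the mixed term $2a \cdot \frac12 \mathrm{trace}\,N$ of the square into
  \<open>minors2 M\<close>, which $|M|^2$ dominates. The slack $\frac14 |N|^2 + d^2$ is what identifies the
  maximizer.
\<close>

lemma grassmannian_degenerate_form:
  assumes "x \<in> grassmannian"
  shows "degenerate_form \<bullet> x \<le> 1" and "degenerate_form \<bullet> x = 1 \<Longrightarrow> eee x = 1 \<and> eef x = 0 \<and> eff x = 0 \<and> fff x = 0"
proof -
  have sq: "(degenerate_form \<bullet> x)\<^sup>2 = (eee x)\<^sup>2 + minors2 (eef x) + (trace (eff x))\<^sup>2 / 4"
    using grassmannian_pluecker(1)[OF assms] by (simp add: degenerate_form_inner power2_eq_square field_simps)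
  note n = grassmannian_norm(2)[OF assms] 
  note i = minors2_le[of "eef x"] trace_power2_le[of "eff x"] inner_ge_zero[of "eff x"] inner_ge_zero[of "eef x"] zero_le_power2[of "fff x"]
  have "(degenerate_form \<bullet> x)\<^sup>2 \<le> 1"
    using n i unfolding sq by linarith
  then show "degenerate_form \<bullet> x \<le> 1"
    by (rule power2_le_imp_le[where y = 1, simplified])
  assume 1: "degenerate_form \<bullet> x = 1"
  have "eff x \<bullet> eff x = 0" and "(fff x)\<^sup>2 = 0"
    using n i sq unfolding 1 power_one by linarith+
  note z = this
  then have "eff x = 0" "fff x = 0" by simp_all
  then have "eee x = 1" using 1 by (simp add: degenerate_form_inner trace_3)
  then have "eef x = 0" using n z by simp
  then show "eee x = 1 \<and> eef x = 0 \<and> eff x = 0 \<and> fff x = 0"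
    using \<open>eff x = 0\<close> \<open>fff x = 0\<close> \<open>eee x = 1\<close> by simp
qed

lemma orbitope_degenerate_form_eq:
  assumes "x \<in> grassmann_orbitope" "degenerate_form \<bullet> x = 1"
  shows "x = e123"
proof -
  have "x \<in> convex hull grassmannian \<inter> {x. degenerate_form \<bullet> x = 1}"
    using assms by (simp add: grassmann_orbitope_hull)
  also have "\<dots> = convex hull (grassmannian \<inter> {x. degenerate_form \<bullet> x = 1})"
    by (rule convex_hull_Int_supporting_hyperplane[OF compact_grassmannian grassmannian_degenerate_form(1)])
  also have "grassmannian \<inter> {x. degenerate_form \<bullet> x = 1} \<subseteq> {e123}"
  proof clarify
    fix x assume "x \<in> grassmannian" "degenerate_form \<bullet> x = 1"
    then show "x = e123"
      using grassmannian_degenerate_form(2) by (intro blocks_eqI) (simp_all add: e123_blocks)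
  qed
  then have "convex hull (grassmannian \<inter> {x. degenerate_form \<bullet> x = 1}) \<subseteq> {e123}"
    by (metis convex_hull_singleton hull_mono)
  finally show ?thesis by blast
qed

lemma remainder_zero:
  fixes g k :: "real \<Rightarrow> real"
  assumes "isCont g 0" "isCont k 0"
    and "\<forall>\<^sub>F s in at 0. \<bar>c + s * g s\<bar> \<le> \<bar>s\<bar> * k s"
  shows "c = 0"
proof -
  have "((\<lambda>s. \<bar>c + s * g s\<bar>) \<longlongrightarrow> \<bar>c + 0 * g 0\<bar>) (at 0)"
    using assms(1) unfolding isCont_def by (intro tendsto_intros)
  moreover have "((\<lambda>s. \<bar>s\<bar> * k s) \<longlongrightarrow> \<bar>0\<bar> * k 0) (at 0)"
    using assms(2) unfolding isCont_def by (intro tendsto_intros)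
  ultimately have "\<bar>c + 0 * g 0\<bar> \<le> \<bar>0\<bar> * k 0"
    using assms(3) by (intro tendsto_le[OF trivial_limit_at]) 
  then show ?thesis by simp
qed

text \<open>
  Dividing by \<open>s\<close> and letting \<open>s\<close> tend to 0, four times in a row.
\<close>

lemma cubic_zero:
  fixes R Q :: "real \<Rightarrow> real"
  assumes cont: "isCont R 0" "isCont Q 0"
    and bound: "\<forall>\<^sub>F s in at 0. \<bar>c0 + s * (c1 + s * (c2 + s * (c3 + s * R s)))\<bar> \<le> s ^ 4 * Q s"
  shows "c0 = 0" "c1 = 0" "c2 = 0" "c3 = 0"
proof -
  have s: "s ^ 4 * Q s = \<bar>s\<bar> * (\<bar>s\<bar> * (\<bar>s\<bar> * (\<bar>s\<bar> * Q s)))" for s :: real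
    by (simp add: power4_eq_xxxx)
  show c0: "c0 = 0"
    using bound unfolding s
    by (intro remainder_zero[where g = "\<lambda>s. c1 + s * (c2 + s * (c3 + s * R s))" and k = "\<lambda>s. \<bar>s\<bar> * (\<bar>s\<bar> * (\<bar>s\<bar> * Q s))"])
      (intro continuous_intros cont)+
  have "\<forall>\<^sub>F s in at 0. \<bar>c1 + s * (c2 + s * (c3 + s * R s))\<bar> \<le> \<bar>s\<bar> * (\<bar>s\<bar> * (\<bar>s\<bar> * Q s))"
    using bound eventually_neq_at_within[of "0::real" 0 UNIV]
  proof eventually_elim
    case (elim s)
    then have "\<bar>s\<bar> * \<bar>c1 + s * (c2 + s * (c3 + s * R s))\<bar> \<le> \<bar>s\<bar> * (\<bar>s\<bar> * (\<bar>s\<bar> * (\<bar>s\<bar> * Q s)))"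
      unfolding c0 s by (simp add: abs_mult mult_ac)
    then show ?case using elim by simp
  qed
  note bound = this
  show c1: "c1 = 0"
    using bound
    by (intro remainder_zero[where g = "\<lambda>s. c2 + s * (c3 + s * R s)" and k = "\<lambda>s. \<bar>s\<bar> * (\<bar>s\<bar> * Q s)"])
      (intro continuous_intros cont)+
  have "\<forall>\<^sub>F s in at 0. \<bar>c2 + s * (c3 + s * R s)\<bar> \<le> \<bar>s\<bar> * (\<bar>s\<bar> * Q s)"
    using bound eventually_neq_at_within[of "0::real" 0 UNIV]
  proof eventually_elim
    case (elim s)
    then have "\<bar>s\<bar> * \<bar>c2 + s * (c3 + s * R s)\<bar> \<le> \<bar>s\<bar> * (\<bar>s\<bar> * (\<bar>s\<bar> * Q s))"
      unfolding c1 by (simp add: abs_mult mult_ac)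
    then show ?case using elim by simp
  qed
  note bound = this
  show c2: "c2 = 0"
    using bound
    by (intro remainder_zero[where g = "\<lambda>s. c3 + s * R s" and k = "\<lambda>s. \<bar>s\<bar> * Q s"])
      (intro continuous_intros cont)+
  have "\<forall>\<^sub>F s in at 0. \<bar>c3 + s * R s\<bar> \<le> \<bar>s\<bar> * Q s"
    using bound eventually_neq_at_within[of "0::real" 0 UNIV]
  proof eventually_elim
    case (elim s)
    then have "\<bar>s\<bar> * \<bar>c3 + s * R s\<bar> \<le> \<bar>s\<bar> * (\<bar>s\<bar> * Q s)"
      unfolding c2 by (simp add: abs_mult mult_ac)
    then show ?case using elim by simp
  qed
  then show "c3 = 0"
    by (rule remainder_zero[OF cont])
qed

text \<open>
  The next four lemmas expand the blocks of the graph of $s \cdot \mathrm{identity} + s^2 X$ in powers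
  of $s$. The direction of the identity matrix is the one in which the second derivative of
  \<open>degenerate_form\<close>, restricted to the Grassmannian, vanishes at $e_1 \wedge e_2 \wedge e_3$; the correction is of order $s^2$, so that it
  affects the gap to the maximum only in order $s^4$.
\<close>

lemma adj3_pencil: "adj3 (mat s + s\<^sup>2 *\<^sub>R X) =
    s\<^sup>2 *\<^sub>R (mat 1 + s *\<^sub>R (mat (trace X) - X) + s\<^sup>2 *\<^sub>R adj3 X)"
  by (simp add: vec_eq_iff forall_3 adj3_def vector_3 mat_def trace_3 power2_eq_square algebra_simps)

lemma det_pencil: "det (mat s + s\<^sup>2 *\<^sub>R X) = s ^ 3 * (1 + s * (trace X + s * (minors2 X + s * det X)))"
  for X :: "real^3^3"
  by (simp add: det_3 mat_def trace_3 minors2_def power2_eq_square power3_eq_cube algebra_simps)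

lemma minors2_pencil: "minors2 (mat s + s\<^sup>2 *\<^sub>R X) = s\<^sup>2 * (3 + 2 * s * trace X + s\<^sup>2 * minors2 X)"
  by (simp add: mat_def trace_3 minors2_def power2_eq_square algebra_simps)

lemma inner_pencil: "(mat s + s\<^sup>2 *\<^sub>R X) \<bullet> (mat s + s\<^sup>2 *\<^sub>R X) = 3 * s\<^sup>2 + 2 * s ^ 3 * trace X + s ^ 4 * (X \<bullet> X)"
  for X :: "real^3^3"
  by (simp add: inner_3_3 mat_def trace_3 power2_eq_square power3_eq_cube power4_eq_xxxx algebra_simps)

text \<open>
  If both \<open>degenerate_form + h\<close> and \<open>degenerate_form - h\<close> lie in the polar body, then
  $|h(x)| \le |x| - \mathrm{degenerate\_form}(x)$ for every decomposable $x$. Along these graphs the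
  right-hand side is of order $s^4$, so the coefficients of $1, s, s^2, s^3$ in $h(x)$ vanish: these
  are the four conclusions.
\<close>

lemma degenerate_form_perturbation:
  assumes P: "degenerate_form + h \<in> polar grassmann_orbitope" "degenerate_form - h \<in> polar grassmann_orbitope"
  shows "eee h = 0" "trace (eef h) = 0" "eef h \<bullet> X + trace (eff h) = 0"
    "eff h \<bullet> (mat (trace X) - X) + fff h = 0"
proof -
  define x where "x s = graph3 1 (mat s + s\<^sup>2 *\<^sub>R X)" for s
  define N where "N s = mat 1 + s *\<^sub>R (mat (trace X) - X) + s\<^sup>2 *\<^sub>R adj3 X" for s
  define d where "d s = 1 + s * (trace X + s * (minors2 X + s * det X))" for s
  define t where "t s = 3 + 2 * s * trace X + s\<^sup>2 * minors2 X" for s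
  define Q where "Q s = X \<bullet> X - minors2 X + N s \<bullet> N s + s\<^sup>2 * (d s)\<^sup>2 - (t s)\<^sup>2 / 4" for s
  define R where "R s = eff h \<bullet> adj3 X + fff h * (trace X + s * (minors2 X + s * det X))" for s
  define q where "q s = 1 + s\<^sup>2 * t s / 2" for s
  have form: "degenerate_form \<bullet> x s = q s" for s
    by (simp add: degenerate_form_inner x_def graph3_blocks trace_adj3 minors2_pencil q_def t_def)
  have norm: "x s \<bullet> x s = 1 + (3 * s\<^sup>2 + 2 * s ^ 3 * trace X + s ^ 4 * (X \<bullet> X)) + s ^ 4 * (N s \<bullet> N s) + s ^ 6 * (d s)\<^sup>2" for s
    unfolding inner_blocks[of "x s"]
    by (simp add: x_def graph3_blocks inner_pencil adj3_pencil det_pencil flip: N_def d_def)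
      (simp add: power_mult_distrib power2_eq_square numeral_eq_Suc)
  have gap: "x s \<bullet> x s - (q s)\<^sup>2 = s ^ 4 * Q s" for s
    unfolding norm q_def Q_def t_def
    by (simp add: power2_eq_square field_simps numeral_eq_Suc)
  have h: "h \<bullet> x s = eee h + s * (trace (eef h) + s * (eef h \<bullet> X + trace (eff h)
      + s * (eff h \<bullet> (mat (trace X) - X) + fff h + s * R s)))" for s
    unfolding inner_blocks[of h] 
    by (simp add: x_def graph3_blocks adj3_pencil det_pencil R_def inner_add_right inner_mat_3)
      (simp add: power2_eq_square power3_eq_cube algebra_simps)
  have cont: "isCont Q 0" "isCont R 0" "isCont q 0"
    unfolding Q_def R_def N_def d_def t_def q_def by (intro continuous_intros; simp)+
  have "\<forall>\<^sub>F s in at 0. q s > 0"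
    using cont(3) unfolding isCont_def by (rule order_tendstoD(1)) (simp add: q_def)
  then have "\<forall>\<^sub>F s in at 0. \<bar>h \<bullet> x s\<bar> \<le> s ^ 4 * Q s"
  proof eventually_elim
    case (elim s)
    have le: "\<bar>h \<bullet> x s\<bar> \<le> norm (x s) - q s"
      using polar_wedge3_le[OF P(1)] polar_wedge3_le[OF P(2)]
      unfolding form[symmetric] x_def graph3_def inner_add_left inner_diff_left
      by (smt (verit, best))
    \<comment> \<open>The first block of \<open>x s\<close> is 1. Hence \<open>norm (x s) + q s \<ge> 1\<close>, and the difference of the norm
      and \<open>q s\<close> is at most the difference of their squares.\<close>
    have "1 \<le> x s \<bullet> x s"
      using inner_ge_zero[of "eef (x s)"] inner_ge_zero[of "eff (x s)"] 
      unfolding inner_blocks[of "x s"] by (simp add: x_def graph3_blocks)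
    then have "1 \<le> norm (x s)"
      by (simp add: norm_eq_sqrt_inner)
    then have "(norm (x s) - q s) * 1 \<le> (norm (x s) - q s) * (norm (x s) + q s)"
      using elim le by (intro mult_left_mono) linarith+
    also have "\<dots> = x s \<bullet> x s - (q s)\<^sup>2"
      by (simp add: power2_norm_eq_inner[symmetric] power2_eq_square algebra_simps)
    finally show ?case using le gap[of s] by simp
  qed
  note cubic_zero[OF cont(2,1) this[unfolded h]]
  then show "eee h = 0" "trace (eef h) = 0" "eef h \<bullet> X + trace (eff h) = 0"
    "eff h \<bullet> (mat (trace X) - X) + fff h = 0" .
qed

text \<open>
  Choosing $X = 0$ kills the traces and the last block; as $X$ is arbitrary, the blocks of \<open>h\<close>
  themselves may then be inserted for it.
\<close>

lemma degenerate_form_rigid: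
  assumes P: "degenerate_form + h \<in> polar grassmann_orbitope" "degenerate_form - h \<in> polar grassmann_orbitope"
  shows "h = 0"
proof -
  note c = degenerate_form_perturbation[OF P]
  have N: "trace (eff h) = 0" and f: "fff h = 0"
    using c(3)[of 0] c(4)[of 0] by (simp_all add: trace_3)
  have "eef h \<bullet> eef h = 0"
    using c(3)[of "eef h"] N by simp
  moreover have "eff h \<bullet> eff h = 0"
    using c(4)[of "eff h"] N f by (simp add: inner_diff_right inner_mat_3)
  ultimately have "h \<bullet> h = 0"
    using c(1) f by (simp add: inner_blocks)
  then show ?thesis by simp
qed

lemma degenerate_form_extreme: "degenerate_form extreme_point_of polar grassmann_orbitope"
  unfolding extreme_point_of_def
proof (intro conjI ballI notI)
  show "degenerate_form \<in> polar grassmann_orbitope"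
    unfolding polar_orbitope using grassmannian_degenerate_form(1) by blast
  fix a b
  assume a: "a \<in> polar grassmann_orbitope" and b: "b \<in> polar grassmann_orbitope" and "degenerate_form \<in> open_segment a b"
  then obtain u where "a \<noteq> b" and u: "0 < u" "u < 1" and form: "degenerate_form = (1 - u) *\<^sub>R a + u *\<^sub>R b"
    unfolding in_segment by blast
  \<comment> \<open>Moving the parameter \<open>u\<close> by \<open>e\<close> in either direction stays within the segment.\<close>
  define e where "e = min u (1 - u)"
  have e: "0 < e" "0 \<le> u - e" "u + e \<le> 1" using u by (auto simp: e_def)
  have mem: "(1 - t) *\<^sub>R a + t *\<^sub>R b \<in> polar grassmann_orbitope" if "0 \<le> t" "t \<le> 1" for t
    using convexD_alt[OF convex_polar a b that] .
  have "e *\<^sub>R (b - a) = 0"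
  proof (rule degenerate_form_rigid)
    have "degenerate_form + e *\<^sub>R (b - a) = (1 - (u + e)) *\<^sub>R a + (u + e) *\<^sub>R b"
      by (simp add: form algebra_simps)
    then show "degenerate_form + e *\<^sub>R (b - a) \<in> polar grassmann_orbitope"
      using mem[of "u + e"] e u by simp
    have "degenerate_form - e *\<^sub>R (b - a) = (1 - (u - e)) *\<^sub>R a + (u - e) *\<^sub>R b"
      by (simp add: form algebra_simps)
    then show "degenerate_form - e *\<^sub>R (b - a) \<in> polar grassmann_orbitope"
      using mem[of "u - e"] e u by simp
  qed
  then show False using e \<open>a \<noteq> b\<close> by simp
qed

text \<open>
  The only point of the orbitope at which the form takes the value 1 is \<open>e123\<close>, so an exposing
  functional is a multiple of it, but \<open>e123\<close> itself is another point of the polar body in the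
  face which that functional cuts out.
\<close>

lemma degenerate_form_not_exposed: "\<not> {degenerate_form} exposed_face_of polar grassmann_orbitope"
proof
  let ?P = "polar grassmann_orbitope"
  assume "{degenerate_form} exposed_face_of ?P"
  then obtain a b where ab: "?P \<subseteq> {x. a \<bullet> x \<le> b}" and eq: "{degenerate_form} = ?P \<inter> {x. a \<bullet> x = b}"
    unfolding exposed_face_of_def by blast
  have phi1: "degenerate_form \<bullet> e123 = 1"
    by (simp add: degenerate_form_inner e123_blocks trace_3)
  have "0 \<in> ?P" by (simp add: polar_def)
  moreover have "0 \<noteq> degenerate_form" using phi1 by auto
  ultimately have "a \<bullet> 0 \<le> b" "a \<bullet> 0 \<noteq> b" using ab eq by blast+
  then have b: "0 < b" by simp
  have "a /\<^sub>R b \<in> grassmann_orbitope"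
  proof (rule bipolar_orbitope)
    fix y assume "y \<in> ?P"
    then have "a \<bullet> y \<le> b" using ab by blast
    then show "(a /\<^sub>R b) \<bullet> y \<le> 1" using b by (simp add: field_simps)
  qed
  moreover have "degenerate_form \<bullet> (a /\<^sub>R b) = 1"
  proof -
    have "a \<bullet> degenerate_form = b" using eq by blast
    then show ?thesis using b by (simp add: inner_commute)
  qed
  ultimately have "a /\<^sub>R b = e123" by (rule orbitope_degenerate_form_eq)
  moreover have "a = b *\<^sub>R (a /\<^sub>R b)" using b by simp
  ultimately have a: "a = b *\<^sub>R e123" by simp
  have "e123 \<in> ?P"
    unfolding polar_orbitope
  proof
    fix g assume "g \<in> grassmannian"
    then have "norm e123 * norm g = 1"
      using grassmannian_norm(1) e123_grassmannian by simp
    then show "e123 \<bullet> g \<le> 1"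
      using norm_cauchy_schwarz[of e123 g] by simp
  qed
  moreover have "a \<bullet> e123 = b"
    by (simp add: a e123_inner e123_blocks)
  ultimately have "e123 = degenerate_form" using eq by blast
  then have "e123 \<bullet> graph3 1 (mat 1) = degenerate_form \<bullet> graph3 1 (mat 1)" by simp
  then show False
    by (simp add: e123_inner degenerate_form_inner graph3_mat_blocks trace_mat_3)
qed

section \<open>An edge of the orbitope that is not exposed\<close>

text \<open>
  The special Lagrangian form $\mathrm{Re}(dz_1 \wedge dz_2 \wedge dz_3)$ with $z_j = x_j + i y_j$, where
  $x_j, y_j$ are the coordinates along $e_j, f_j$.
\<close>

definition sl_form :: "real ^ triple" where
  "sl_form = axis (Abs_triple (0, 1, 2)) 1 - (axis (Abs_triple (0,4,5)) 1
    - axis (Abs_triple (1,3,5)) 1 + axis (Abs_triple (2,3,4)) 1)"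

lemma sl_form_inner: "sl_form \<bullet> x = eee x - trace (eff x)"
  by (simp add: sl_form_def inner_axis' inner_left_distrib inner_diff_left eee_def eff_def trace_3 vector_3 coord_def)

text \<open>
  On decomposable unit vectors the squares of the real and the imaginary part of
  $dz_1 \wedge dz_2 \wedge dz_3$ and of the contraction with the Kaehler form add up to 1; the
  contraction consists of the antisymmetric parts of \<open>M\<close> and \<open>N\<close>. If the real part is 1, everything
  else vanishes. With \<open>M\<close>, \<open>N\<close> symmetric, the Cauchy--Schwarz inequality for both traces confines
  $(\mathrm{trace}\,M)^2$ to the interval from $3a(a-1)$ to $\frac13(a-1)^2$, which is empty for
  $a < -\frac18$ and a single point for $a = -\frac18$.
\<close>

lemma grassmannian_sl_form:
  assumes "x \<in> grassmannian"
  shows "sl_form \<bullet> x \<le> 1" and "sl_form \<bullet> x = 1 \<Longrightarrow> - 1 / 8 \<le> eee x"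
   and "sl_form \<bullet> x = 1 \<Longrightarrow> eee x = - 1 / 8 \<Longrightarrow> \<exists>m. m\<^sup>2 = 27 / 64 \<and> eef x = mat (m / 3) \<and> eff x = mat (- 3 / 8) \<and> fff x = m"
proof -
  let ?M = "eef x" and ?N = "eff x"
  define k where "k A = (A$1$2 - A$2$1)\<^sup>2 + (A$1$3 - A$3$1)\<^sup>2 + (A$2$3 - A$3$2)\<^sup>2" for A :: "real^3^3"
  have k0: "k A \<ge> 0" for A by (simp add: k_def)
  note n = grassmannian_norm(2)[OF assms] 
  note tM = minors2_trace[of ?M, folded k_def] and tN = minors2_trace[of ?N, folded k_def]
  \<comment> \<open>The antisymmetric parts enter through the traces of \<open>M\<close> and \<open>N\<close>, the mixed terms through the
    Pluecker relations.\<close>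
  have "(sl_form \<bullet> x)\<^sup>2 + (trace ?M - fff x)\<^sup>2 + k ?M + k ?N = 1"
    using n grassmannian_pluecker[OF assms] tM tN
    unfolding sl_form_inner by (simp add: power2_diff algebra_simps)
  note id = this
  have "(sl_form \<bullet> x)\<^sup>2 \<le> 1"
    using id k0[of ?M] k0[of ?N] zero_le_power2[of "trace ?M - fff x"] by linarith
  then show "sl_form \<bullet> x \<le> 1"
    by (rule power2_le_imp_le[where y = 1, simplified])
  assume 1: "sl_form \<bullet> x = 1"
  have z: "k ?M = 0" "k ?N = 0" "(trace ?M - fff x)\<^sup>2 = 0"
    using id 1 k0[of ?M] k0[of ?N] zero_le_power2[of "trace ?M - fff x"] by (smt (verit) power_one)+
  define a where "a = eee x"
  define m where "m = trace ?M"
  have f: "fff x = m" using z by (simp add: m_def)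
  have t: "trace ?N = a - 1" using 1 by (simp add: sl_form_inner a_def)
  have M: "?M \<bullet> ?M = m\<^sup>2 - 2 * (a * (a - 1))"
    using tM z grassmannian_pluecker(1)[OF assms] by (simp add: t m_def a_def)
  have N: "?N \<bullet> ?N = (a - 1)\<^sup>2 - 2 * m\<^sup>2"
    using tN z grassmannian_pluecker(2)[OF assms] by (simp add: t f m_def power2_eq_square)
  have 2: "m\<^sup>2 \<ge> 3 * (a * (a - 1))" using trace_power2_le[of ?M] M by (simp add: m_def)
  have 3: "3 * m\<^sup>2 \<le> (a - 1)\<^sup>2" using trace_power2_le[of ?N] N by (simp add: t)
  have 4: "(1 - a) * (- 9 * a) \<le> (1 - a) * (1 - a)"
    using 2 3 by (simp add: power2_eq_square algebra_simps)
  show 5: "- 1 / 8 \<le> eee x"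
  proof (cases "a < 1")
    case True
    then have "- 9 * a \<le> 1 - a" by (intro mult_left_le_imp_le[OF 4]) simp
    then show ?thesis by (simp add: a_def)
  qed (simp add: a_def)
  assume a: "eee x = - 1 / 8"
  have a': "a = - 1 / 8" using a a_def by simp
  have m: "m\<^sup>2 = 27 / 64" using 2 3 unfolding a' by (simp add: power2_eq_square)
  have "?M = mat (m / 3)"
    using trace_power2_eqD[of ?M] M m unfolding a' by (simp add: m_def)
  moreover have "?N = mat (- 3 / 8)"
    using trace_power2_eqD[of ?N] N m unfolding t a' by (simp add: power2_eq_square)
  ultimately show "\<exists>m. m\<^sup>2 = 27 / 64 \<and> ?M = mat (m / 3) \<and> ?N = mat (- 3 / 8) \<and> fff x = m"
    using f m by blast
qed

lemma sl_form_e123_le: "x \<in> grassmannian \<Longrightarrow> sl_form \<bullet> x = 1 \<Longrightarrow> - e123 \<bullet> x \<le> 1 / 8"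
proof -
  assume "x \<in> grassmannian" "sl_form \<bullet> x = 1"
  then have "- 1 / 8 \<le> eee x" by (rule grassmannian_sl_form(2))
  then show ?thesis by (simp add: e123_inner)
qed

text \<open>
  Since $\cos(\pm 2\pi/3) = -\frac12$ and $\sin(\pm 2\pi/3) = \pm\frac{\sqrt3}{2}$, the ends of the edge are
  $e_1 \wedge e_2 \wedge e_3$ turned by these two angles.
\<close>

definition edge_end :: "real \<Rightarrow> real ^ triple" where "edge_end s = graph3 (- 1 / 2) (mat s)"

definition sl_edge :: "(real ^ triple) set" where "sl_edge = convex hull {edge_end (sqrt 3 / 2), edge_end (- (sqrt 3 / 2))}"

lemma sqrt3_half: "(sqrt 3 / 2)\<^sup>2 = 3 / 4"
  by (simp add: power_divide)

lemma sl_edge_eq: "sl_edge = (grassmann_orbitope \<inter> {x. sl_form \<bullet> x = 1}) \<inter> {x. - e123 \<bullet> x = 1 / 8}"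
proof -
  let ?S = "grassmannian \<inter> {x. sl_form \<bullet> x = 1}"
  have hull: "grassmann_orbitope \<inter> {x. sl_form \<bullet> x = 1} = convex hull ?S"
    unfolding grassmann_orbitope_hull
    by (rule convex_hull_Int_supporting_hyperplane[OF compact_grassmannian grassmannian_sl_form(1)])
  have "compact ?S"
    by (intro compact_Int_closed compact_grassmannian closed_hyperplane)
  then have "convex hull ?S \<inter> {x. - e123 \<bullet> x = 1 / 8} = convex hull (?S \<inter> {x. - e123 \<bullet> x = 1 / 8})"
    using sl_form_e123_le by (intro convex_hull_Int_supporting_hyperplane) blast+
  also have "?S \<inter> {x. - e123 \<bullet> x = 1 / 8} = {edge_end (sqrt 3 / 2), edge_end (- (sqrt 3 / 2))}"
  proof (intro set_eqI iffI)
    fix x assume x: "x \<in> ?S \<inter> {x. - e123 \<bullet> x = 1 / 8}"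
    then obtain m where m: "m\<^sup>2 = 27 / 64" "eef x = mat (m / 3)" "eff x = mat (- 3 / 8)" "fff x = m"
      using grassmannian_sl_form(3)[of x] by (auto simp: e123_inner)
    have e: "eee x = - 1 / 8" using x by (auto simp: e123_inner)
    \<comment> \<open>The two signs of the square root are the two rotation directions.\<close>
    have "m\<^sup>2 = (3 * sqrt 3 / 8)\<^sup>2" using m(1) by (simp add: power_mult_distrib power_divide)
    then have "m = 3 * sqrt 3 / 8 \<or> m = - (3 * sqrt 3 / 8)" by (simp only: power2_eq_iff)
    moreover define s where "s = 4 * m / 3"
    ultimately have s: "s = sqrt 3 / 2 \<or> s = - (sqrt 3 / 2)" "m = 3 * s / 4" by auto
    have s2: "s\<^sup>2 = 3 / 4" using s(1) sqrt3_half by (metis power2_minus)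
    then have s3: "s ^ 3 = 3 * s / 4" by (simp add: power3_eq_cube power2_eq_square)
    then have "x = edge_end s"
      unfolding edge_end_def using m e s(2)
      by (intro blocks_eqI) (simp_all add: graph3_mat_blocks s2 s3 power_divide)
    then show "x \<in> {edge_end (sqrt 3 / 2), edge_end (- (sqrt 3 / 2))}" using s(1) by blast
  next
    have "edge_end s \<in> ?S \<inter> {x. - e123 \<bullet> x = 1 / 8}" if s: "s\<^sup>2 = 3 / 4" for s
    proof -
      have "edge_end s \<in> grassmannian"
        unfolding edge_end_def using s by (intro graph3_grassmannian) (simp add: power_divide)
      moreover have "sl_form \<bullet> edge_end s = 1" "- e123 \<bullet> edge_end s = 1 / 8"
        using s by (simp_all add: sl_form_inner e123_inner edge_end_def graph3_mat_blocks trace_mat_3 power_divide)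
      ultimately show ?thesis by blast
    qed
    moreover fix x assume "x \<in> {edge_end (sqrt 3 / 2), edge_end (- (sqrt 3 / 2))}"
    ultimately show "x \<in> ?S \<inter> {x. - e123 \<bullet> x = 1 / 8}"
      using sqrt3_half by (metis insert_iff power2_minus singletonD)
  qed
  finally show ?thesis unfolding hull sl_edge_def by simp
qed

text \<open>
  A face of the special Lagrangian face of the orbitope is a face of the orbitope.
\<close>

lemma sl_edge_edge_of: "sl_edge edge_of grassmann_orbitope"
  unfolding edge_of_def
proof
  let ?F = "grassmann_orbitope \<inter> {x. sl_form \<bullet> x = 1}"
  have F: "?F face_of grassmann_orbitope"
    by (intro face_of_Int_supporting_hyperplane_le convex_orbitope orbitope_leI[OF _ grassmannian_sl_form(1)])
  have hull: "?F = convex hull (grassmannian \<inter> {x. sl_form \<bullet> x = 1})"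
    unfolding grassmann_orbitope_hull
    by (rule convex_hull_Int_supporting_hyperplane[OF compact_grassmannian grassmannian_sl_form(1)])
  have "?F \<subseteq> {x. - e123 \<bullet> x \<le> 1 / 8}"
    unfolding hull using sl_form_e123_le by (intro hull_minimal convex_halfspace_le) blast
  then have "sl_edge face_of ?F"
    unfolding sl_edge_eq using F face_of_imp_convex by (intro face_of_Int_supporting_hyperplane_le) auto
  then show "sl_edge face_of grassmann_orbitope" using F by (rule face_of_trans)
  have "fff (edge_end (sqrt 3 / 2)) \<noteq> fff (edge_end (- (sqrt 3 / 2)))"
    by (simp add: edge_end_def graph3_mat_blocks)
  then have "edge_end (sqrt 3 / 2) \<noteq> edge_end (- (sqrt 3 / 2))" by metis
  then show "aff_dim sl_edge = 1"
    by (simp add: sl_edge_def aff_dim_convex_hull aff_dim_2)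
qed

text \<open>
  A functional \<open>y\<close> exposing the edge would be maximal at both ends of it, and therefore along the circle
  \<open>graph3 (cos t) (mat (sin t))\<close> at two angles where $\cos 3t = 1$. Values and first derivatives at
  these angles determine it on the circle, and it takes the same value at the angle 0.
\<close>

lemma sl_edge_not_exposed: "\<not> sl_edge exposed_face_of grassmann_orbitope"
proof
  assume "sl_edge exposed_face_of grassmann_orbitope"
  then obtain y b where le: "grassmann_orbitope \<subseteq> {x. y \<bullet> x \<le> b}" and eq: "sl_edge = grassmann_orbitope \<inter> {x. y \<bullet> x = b}"
    unfolding exposed_face_of_def by blast
  define g where "g t = eee y * cos t ^ 3 + trace (eef y) * (cos t)\<^sup>2 * sin t + trace (eff y) * cos t * (sin t)\<^sup>2 + fff y * sin t ^ 3" for t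
  have g: "g t = y \<bullet> graph3 (cos t) (mat (sin t))" for t
    by (simp add: g_def inner_graph3_mat)
  have gb: "g t \<le> b" for t
    unfolding g using le grassmannian_subset_orbitope graph3_grassmannian[OF sin_cos_squared_add2] by blast
  have crit: "eee y = b" if "cos t = - 1 / 2" "sin t = sqrt 3 / 2" for t
  proof -
    have max: "g s = b" if "s = t \<or> s = - t" for s
    proof -
      have "cos s = - 1 / 2" "sin s = sqrt 3 / 2 \<or> sin s = - (sqrt 3 / 2)"
        using that \<open>cos t = - 1 / 2\<close> \<open>sin t = sqrt 3 / 2\<close> by auto
      then have "graph3 (cos s) (mat (sin s)) \<in> {edge_end (sqrt 3 / 2), edge_end (- (sqrt 3 / 2))}"
        unfolding edge_end_def by (metis insertI1 insertI2)
      then have "graph3 (cos s) (mat (sin s)) \<in> sl_edge"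
        unfolding sl_edge_def by (rule hull_inc)
      then have "y \<bullet> graph3 (cos s) (mat (sin s)) = b" unfolding eq by blast
      then show ?thesis by (simp add: g)
    qed
    define g' where "g' s = - 3 * eee y * (cos s)\<^sup>2 * sin s + trace (eef y) * (cos s ^ 3 - 2 * cos s * (sin s)\<^sup>2)
       + trace (eff y) * (2 * (cos s)\<^sup>2 * sin s - sin s ^ 3) + 3 * fff y * (sin s)\<^sup>2 * cos s" for s
    have "(g has_real_derivative g' s) (at s)" for s
      unfolding g_def g'_def 
      by (auto intro!: derivative_eq_intros simp: power2_eq_square power3_eq_cube algebra_simps)
    then have "g' s = 0" if "s = t \<or> s = - t" for s
      using DERIV_local_max[of g "g' s" s 1] max[OF that] gb by simp
    then have "g' t = 0" "g' (- t) = 0" by auto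
    \<comment> \<open>The two derivatives differ only in the signs of the terms odd in \<open>sin t\<close>; subtracting them isolates
      those terms.\<close>
    moreover have cube: "(sqrt 3 / 2) ^ 3 = 3 / 4 * (sqrt 3 / 2)"
      using sqrt3_half by (simp add: power3_eq_cube power2_eq_square)
    ultimately have "sqrt 3 * (3 * eee y + trace (eff y)) = 0"
      unfolding g'_def cos_minus sin_minus that power_minus_odd[OF odd_numeral] power2_minus sqrt3_half cube
      by (simp add: field_simps power2_eq_square)
    then have "trace (eff y) = - 3 * eee y" by simp
    \<comment> \<open>Adding the two values removes the terms odd in \<open>sin t\<close>.\<close>
    moreover have "g t + g (- t) = 2 * b" using max by simp
    ultimately show ?thesis
      unfolding g_def by (simp add: that sqrt3_half power_divide)
  qed
  have "eee y = b"
    by (rule crit[of "2 * pi / 3"]) (simp_all add: cos_120 sin_120)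
  then have "e123 \<in> sl_edge"
    unfolding eq using e123_grassmannian grassmannian_subset_orbitope by (auto simp: inner_commute[of y] e123_inner)
  then have "eee e123 = - 1 / 8" by (auto simp: sl_edge_eq e123_inner)
  then show False by (simp add: e123_blocks)
qed

section \<open>Faces of spectrahedra are exposed\<close>

text \<open>
  Positive semidefinite bilinear forms on sequences. Sequences, rather than matrices of a fixed size,
  allow an induction on the size that composes the forms with a projection.
\<close>

definition psd_form :: "((nat \<Rightarrow> real) \<Rightarrow> (nat \<Rightarrow> real) \<Rightarrow> real) \<Rightarrow> bool"
  where "psd_form B \<longleftrightarrow> (\<forall>u v. B u v = B v u) \<and> (\<forall>u. 0 \<le> B u u) \<and>
    (\<forall>s t u v w. B (\<lambda>i. s * u i + t * v i) w = s * B u w + t * B v w)"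

lemma psd_formD:
  assumes "psd_form B"
  shows "B u v = B v u" "0 \<le> B u u"
    "B (\<lambda>i. s * u i + t * v i) w = s * B u w + t * B v w"
    "B w (\<lambda>i. s * u i + t * v i) = s * B w u + t * B w v"
  using assms unfolding psd_form_def by metis+

lemma psd_form_add_self:
  assumes "psd_form B"
  shows "B (\<lambda>i. s * u i + t * v i) (\<lambda>i. s * u i + t * v i) = s\<^sup>2 * B u u + 2 * s * t * B u v + t\<^sup>2 * B v v"
  using psd_formD(1)[OF assms, of v u]
  by (simp add: psd_formD(3,4)[OF assms] power2_eq_square algebra_simps)

lemma psd_form_add_le:
  assumes "psd_form B"
  shows "B (\<lambda>i. u i + t * v i) (\<lambda>i. u i + t * v i) \<le> 2 * B u u + 2 * t\<^sup>2 * B v v"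
proof -
  have "0 \<le> B (\<lambda>i. 1 * u i + (- t) * v i) (\<lambda>i. 1 * u i + (- t) * v i)"
    by (rule psd_formD(2)[OF assms])
  then show ?thesis
    using psd_form_add_self[OF assms, of 1 u t v] psd_form_add_self[OF assms, of 1 u "- t" v] by (simp add: mult_ac add_ac)
qed

text \<open>
  Isotropic vectors of a semidefinite form lie in its radical: otherwise \<open>B (u + t v) (u + t v)\<close> would
  be a nonconstant affine function of \<open>t\<close>.
\<close>

lemma psd_form_isotropic:
  assumes B: "psd_form B" and "B v v = 0"
  shows "B u v = 0"
proof (rule ccontr)
  assume "B u v \<noteq> 0"
  \<comment> \<open>Chosen so that \<open>u + t v\<close> would have the value \<open>- 1\<close>.\<close>
  define t where "t = - (B u u + 1) / (2 * B u v)"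
  have "0 \<le> B (\<lambda>i. 1 * u i + t * v i) (\<lambda>i. 1 * u i + t * v i)"
    by (rule psd_formD(2)[OF B])
  also have "\<dots> = - 1"
    using \<open>B u v \<noteq> 0\<close> unfolding psd_form_add_self[OF B] t_def by (simp add: \<open>B v v = 0\<close> field_simps)
  finally show False by simp
qed

text \<open>
  On a finite-dimensional space a semidefinite form is dominated by a multiple of any other one whose
  kernel it contains in its own. The induction splits off one coordinate vector \<open>w\<close> by the projection along \<open>w\<close> onto
  its \<open>A\<close>-orthogonal complement, so that \<open>A\<close> becomes an orthogonal sum, while \<open>B\<close> is at most
  doubled.
\<close>

lemma psd_form_dominated:
  assumes "psd_form A" "psd_form B" "\<And>v. A v v = 0 \<Longrightarrow> B v v = 0"
  shows "\<exists>c\<ge>0. \<forall>v. (\<forall>i\<ge>m. v i = 0) \<longrightarrow> B v v \<le> c * A v v"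
  using assms
proof (induction m arbitrary: A B)
  case 0
  have "B v v = 0" if "\<forall>i\<ge>0. v i = 0" for v
  proof -
    have "v = (\<lambda>i. 0 * v i + 0 * v i)"
      using that by auto
    then have "B v v = 0 * B v v + 0 * B v v"
      using psd_formD(3)[OF 0(2), of 0 v 0 v v] by metis
    then show ?thesis by simp
  qed
  then show ?case by (intro exI[of _ 0]) auto
next
  case (Suc m)
  define w where "w = (\<lambda>i. if i = m then 1 else 0 :: real)"
  \<comment> \<open>If \<open>A w w = 0\<close>, division by 0 turns \<open>\<pi>\<close> into the identity, and \<open>w\<close> lies in the radical of both forms.\<close>
  define \<pi> where "\<pi> u = (\<lambda>i. 1 * u i + (- (A u w / A w w)) * w i)" for u
  note A = psd_formD[OF Suc.prems(1)] and B = psd_formD[OF Suc.prems(2)]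
  have lin: "\<pi> (\<lambda>i. s * u i + t * v i) = (\<lambda>i. s * \<pi> u i + t * \<pi> v i)" for s t u v
    by (auto simp: \<pi>_def A(3) add_divide_distrib algebra_simps)
  have psd: "psd_form (\<lambda>u v. C (\<pi> u) (\<pi> v))" if "psd_form C" for C
    unfolding psd_form_def lin
  proof (intro conjI allI)
    show "C (\<pi> u) (\<pi> v) = C (\<pi> v) (\<pi> u)" for u v using that by (rule psd_formD(1))
    show "0 \<le> C (\<pi> u) (\<pi> u)" for u using that by (rule psd_formD(2))
    show "C (\<lambda>i. s * \<pi> u i + t * \<pi> v i) (\<pi> x) = s * C (\<pi> u) (\<pi> x) + t * C (\<pi> v) (\<pi> x)"
      for s t u v x using that by (rule psd_formD(3))
  qed
  obtain c where c: "c \<ge> 0" "\<And>v. \<forall>i\<ge>m. v i = 0 \<Longrightarrow> B (\<pi> v) (\<pi> v) \<le> c * A (\<pi> v) (\<pi> v)"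
    using Suc.IH[OF psd[OF Suc.prems(1)] psd[OF Suc.prems(2)] Suc.prems(3)] by blast
  have orth: "A (\<pi> u) w = 0" for u
  proof (cases "A w w = 0")
    case True
    then show ?thesis by (rule psd_form_isotropic[OF Suc.prems(1)])
  next
    case False
    then show ?thesis unfolding \<pi>_def A(3) by simp
  qed
  define k where "k = (if A w w = 0 then 0 else B w w / A w w)"
  have k: "k \<ge> 0" "B w w = k * A w w"
    using A(2)[of w] B(2)[of w] Suc.prems(3)[of w] by (auto simp: k_def)
  show ?case
  proof (intro exI[of _ "2 * max c k"] conjI allI impI)
    show "0 \<le> 2 * max c k" using c by simp
    fix v :: "nat \<Rightarrow> real"
    assume v: "\<forall>i\<ge>Suc m. v i = 0"
    define v' where "v' = (\<lambda>i. if i < m then v i else 0)"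
    define t where "t = v m + A v' w / A w w"
    have vt: "v = (\<lambda>i. \<pi> v' i + t * w i)"
      using v by (auto simp: v'_def \<pi>_def t_def w_def fun_eq_iff not_less le_less_Suc_eq Suc_le_eq algebra_simps)
    have Av: "A v v = A (\<pi> v') (\<pi> v') + t\<^sup>2 * A w w"
      using psd_form_add_self[OF Suc.prems(1), of 1 "\<pi> v'" t w] by (simp add: orth flip: vt)
    have "B v v \<le> 2 * B (\<pi> v') (\<pi> v') + 2 * t\<^sup>2 * B w w"
      using psd_form_add_le[OF Suc.prems(2), of "\<pi> v'" t w] by (simp flip: vt)
    also have "B (\<pi> v') (\<pi> v') \<le> c * A (\<pi> v') (\<pi> v')"
      by (rule c(2)) (simp add: v'_def)
    also have "c * A (\<pi> v') (\<pi> v') \<le> max c k * A (\<pi> v') (\<pi> v')"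
      by (intro mult_right_mono A(2)) simp
    also have "2 * t\<^sup>2 * B w w \<le> 2 * t\<^sup>2 * (max c k * A w w)"
      unfolding k(2) by (intro mult_left_mono mult_right_mono A(2)) auto
    finally show "B v v \<le> 2 * max c k * A v v"
      unfolding Av by (simp add: algebra_simps)
  qed
qed

lemma psd_form_mat:
  assumes "symmetric_mat m M" "psd_mat m M"
  shows "psd_form (\<lambda>u v. \<Sum>r<m. \<Sum>c<m. u r * M r c * v c)"
  unfolding psd_form_def
proof (intro conjI allI)
  fix u v w :: "nat \<Rightarrow> real" and s t :: real
  have "(\<Sum>r<m. \<Sum>c<m. u r * M r c * v c) = (\<Sum>c<m. \<Sum>r<m. u r * M r c * v c)"
    by (rule sum.swap)
  also have "\<dots> = (\<Sum>r<m. \<Sum>c<m. v r * M r c * u c)"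
    using assms(1) by (intro sum.cong refl) (simp add: symmetric_mat_def)
  finally show "(\<Sum>r<m. \<Sum>c<m. u r * M r c * v c) = (\<Sum>r<m. \<Sum>c<m. v r * M r c * u c)" .
  show "0 \<le> (\<Sum>r<m. \<Sum>c<m. u r * M r c * u c)"
    using assms(2) by (simp add: psd_mat_def)
  show "(\<Sum>r<m. \<Sum>c<m. (s * u r + t * v r) * M r c * w c) =
     s * (\<Sum>r<m. \<Sum>c<m. u r * M r c * w c) + t * (\<Sum>r<m. \<Sum>c<m. v r * M r c * w c)"
    by (simp add: sum_distrib_left sum.distrib algebra_simps)
qed

lemma psd_mat_dominated:
  assumes M: "symmetric_mat m M" "psd_mat m M" and N: "symmetric_mat m N" "psd_mat m N"
    and ker: "\<And>v. (\<Sum>r<m. \<Sum>c<m. v r * M r c * v c) = 0 \<Longrightarrow> (\<Sum>r<m. \<Sum>c<m. v r * N r c * v c) = 0"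
  shows "\<exists>k\<ge>0. \<forall>v. (\<Sum>r<m. \<Sum>c<m. v r * N r c * v c) \<le> k * (\<Sum>r<m. \<Sum>c<m. v r * M r c * v c)"
proof -
  obtain k where k: "k \<ge> 0" "\<And>v. \<forall>i\<ge>m. v i = 0 \<Longrightarrow>
    (\<Sum>r<m. \<Sum>c<m. v r * N r c * v c) \<le> k * (\<Sum>r<m. \<Sum>c<m. v r * M r c * v c)"
    using psd_form_dominated[OF psd_form_mat[OF M] psd_form_mat[OF N] ker, of m] by blast
  have "(\<Sum>r<m. \<Sum>c<m. v r * N r c * v c) \<le> k * (\<Sum>r<m. \<Sum>c<m. v r * M r c * v c)" for v
  proof -
    have "(\<Sum>r<m. \<Sum>c<m. (if r < m then v r else 0) * K r c * (if c < m then v c else 0)) =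
      (\<Sum>r<m. \<Sum>c<m. v r * K r c * v c)" for K :: "nat \<Rightarrow> nat \<Rightarrow> real"
      by (intro sum.cong refl) simp
    then show ?thesis
      using k(2)[of "\<lambda>i. if i < m then v i else 0"] by simp
  qed
  with k(1) show ?thesis by blast
qed

text \<open>
  Let \<open>x\<close> be a relative interior point of the face \<open>F\<close>. Then \<open>F\<close> consists of the points \<open>y\<close> whose matrix
  annihilates the kernel of the matrix of \<open>x\<close>. Indeed, if it does, the matrix of \<open>y\<close> is dominated by that
  of \<open>x\<close>, so the segment from \<open>y\<close> to \<open>x\<close> can be prolonged within the spectrahedron and \<open>y\<close> is in \<open>F\<close>;
  conversely the segment from any point of \<open>F\<close> to \<open>x\<close> can be prolonged within \<open>F\<close>. Each kernel vector
  \<open>v\<close> contributes the exposed face where the affine function \<open>q y v\<close> of \<open>y\<close> is 0, and intersections of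
  exposed faces are exposed.
\<close>

lemma spectrahedron_face_exposed:
  fixes S :: "(real ^ 'n) set"
  assumes "spectrahedron S" and F: "F face_of S"
  shows "F exposed_face_of S"
proof (cases "F = {}")
  case True
  then show ?thesis by simp
next
  case False
  obtain m A0 and A :: "'n \<Rightarrow> nat \<Rightarrow> nat \<Rightarrow> real"
    where sym: "symmetric_mat m A0" "\<And>i. symmetric_mat m (A i)"
      and S: "S = {x. psd_mat m (\<lambda>r c. A0 r c + (\<Sum>i\<in>UNIV. x $ i * A i r c))}"
    using assms(1) unfolding spectrahedron_def by blast
  define L where "L x = (\<lambda>r c. A0 r c + (\<Sum>i\<in>UNIV. x $ i * A i r c))" for x :: "real ^ 'n"
  define q where "q x v = (\<Sum>r<m. \<Sum>c<m. v r * L x r c * v c)" for x v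
  have symL: "symmetric_mat m (L x)" for x
    using sym by (simp add: symmetric_mat_def L_def)
  have S': "x \<in> S \<longleftrightarrow> (\<forall>v. 0 \<le> q x v)" for x
    by (simp add: S psd_mat_def q_def L_def)
  have psdL: "psd_mat m (L x)" if "x \<in> S" for x
    using that by (simp add: S L_def)
  define g :: "(nat \<Rightarrow> real) \<Rightarrow> real ^ 'n"
    where "g v = (\<chi> i. \<Sum>r<m. \<Sum>c<m. v r * A i r c * v c)" for v
  define h where "h v = (\<Sum>r<m. \<Sum>c<m. v r * A0 r c * v c)" for v
  have qg: "q x v = h v + g v \<bullet> x" for x v
  proof -
    have "g v \<bullet> x = (\<Sum>i\<in>UNIV. \<Sum>r<m. \<Sum>c<m. v r * (x $ i * A i r c) * v c)"
      unfolding inner_vec_def g_def vec_lambda_beta inner_real_def sum_distrib_right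
      by (intro sum.cong refl) (simp only: ac_simps)
    also have "\<dots> = (\<Sum>r<m. \<Sum>c<m. \<Sum>i\<in>UNIV. v r * (x $ i * A i r c) * v c)"
      by (rule trans[OF sum.swap sum.cong[OF refl sum.swap]])
    also have "\<dots> = (\<Sum>r<m. \<Sum>c<m. v r * (\<Sum>i\<in>UNIV. x $ i * A i r c) * v c)"
      by (simp only: sum_distrib_left sum_distrib_right)
    finally show ?thesis
      by (simp only: q_def L_def h_def distrib_left distrib_right sum.distrib)
  qed
  have half: "x \<in> S \<longleftrightarrow> (\<forall>v. - h v \<le> g v \<bullet> x)" for x
    unfolding S' qg by (intro all_cong1) linarith
  then have "S = (\<Inter>v. {x. g v \<bullet> x \<ge> - h v})"
    by blast
  then have "convex S"
    by (simp add: convex_INT convex_halfspace_ge)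
  have exp: "{y \<in> S. q y v = 0} exposed_face_of S" for v
  proof -
    have "q y v = 0 \<longleftrightarrow> g v \<bullet> y = - h v" for y
      unfolding qg by linarith
    then have "{y \<in> S. q y v = 0} = S \<inter> {y. g v \<bullet> y = - h v}"
      by blast
    moreover have "- h v \<le> g v \<bullet> x" if "x \<in> S" for x
      using that half by blast
    ultimately show ?thesis
      by (simp add: exposed_face_of_Int_supporting_hyperplane_ge[OF \<open>convex S\<close>])
  qed
  obtain x where x: "x \<in> rel_interior F"
    using False rel_interior_eq_empty face_of_imp_convex[OF F] by blast
  have xF: "x \<in> F" and xS: "x \<in> S"
    using x rel_interior_subset face_of_imp_subset[OF F] by blast+
  have "F = (\<Inter>v\<in>{v. q x v = 0}. {y \<in> S. q y v = 0})" (is "F = ?I")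
  proof
    show "F \<subseteq> ?I"
    proof (intro subsetI INT_I CollectI)
      fix y v
      assume y: "y \<in> F" and "v \<in> {v. q x v = 0}"
      then have v: "q x v = 0" by blast
      have "y \<in> affine hull F"
        using y by (rule hull_inc)
      then obtain e where e: "e > 1" "(1 - e) *\<^sub>R y + e *\<^sub>R x \<in> F"
        using convex_rel_interior_if[OF face_of_imp_convex[OF F] x] by (meson dual_order.refl less_add_one)
      have yS: "y \<in> S" and zS: "(1 - e) *\<^sub>R y + e *\<^sub>R x \<in> S"
        using y e(2) face_of_imp_subset[OF F] by blast+
      have "q ((1 - e) *\<^sub>R y + e *\<^sub>R x) v = (1 - e) * q y v + e * q x v"
        unfolding qg by (simp add: inner_add_right algebra_simps)
      moreover have "0 \<le> q ((1 - e) *\<^sub>R y + e *\<^sub>R x) v" and 0: "0 \<le> q y v"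
        using zS yS S' by blast+
      ultimately have "(e - 1) * q y v \<le> 0"
        using v by (simp add: algebra_simps)
      then have "q y v = 0"
        using e(1) 0 by (simp add: mult_le_0_iff)
      with yS show "y \<in> S \<and> q y v = 0" by blast
    qed
    show "?I \<subseteq> F"
    proof
      fix y
      assume y: "y \<in> ?I"
      have "q x (\<lambda>_. 0) = 0" by (simp add: q_def)
      with y have yS: "y \<in> S" by blast
      have "q y v = 0" if "q x v = 0" for v using y that by blast
      then have "\<exists>k\<ge>0. \<forall>v. q y v \<le> k * q x v"
        unfolding q_def by (intro psd_mat_dominated symL psdL xS yS)
      then obtain k where k: "k \<ge> 0" "\<And>v. q y v \<le> k * q x v"
        by blast
      \<comment> \<open>Small enough for \<open>(1 + e) q x v - e q y v\<close> to stay nonnegative.\<close>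
      define e where "e = 1 / (k + 1)"
      have e: "e > 0" "e * k \<le> 1" using k(1) by (simp_all add: e_def field_simps)
      define z where "z = x + e *\<^sub>R (x - y)"
      have "z \<in> S"
        unfolding S'
      proof
        fix v
        have "e * q y v \<le> e * (k * q x v)"
          using k(2) e by (intro mult_left_mono) auto
        also have "\<dots> \<le> 1 * q x v"
          using e xS S' unfolding mult.assoc[symmetric] by (intro mult_right_mono) auto
        also have "\<dots> \<le> q x v + e * q x v"
          using e xS S' by simp
        finally show "0 \<le> q z v"
          by (simp add: z_def qg inner_add_right inner_diff_right algebra_simps)
      qed
      show "y \<in> F"
      proof (cases "y = x")
        case False
        have "x = (1 - e / (1 + e)) *\<^sub>R z + (e / (1 + e)) *\<^sub>R y"
        proof -
          have "(1 + e) *\<^sub>R ((1 - e / (1 + e)) *\<^sub>R z + (e / (1 + e)) *\<^sub>R y) = z + e *\<^sub>R y"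
            using e by (simp add: scaleR_add_right right_diff_distrib)
          also have "\<dots> = (1 + e) *\<^sub>R x" by (simp add: z_def algebra_simps)
          finally show ?thesis using e by simp
        qed
        moreover have "z \<noteq> y"
        proof
          assume "z = y"
          then have "(1 + e) *\<^sub>R (x - y) = 0" by (simp add: z_def algebra_simps)
          then show False using e False by simp
        qed
        ultimately have "x \<in> open_segment z y"
          using e unfolding in_segment by (intro conjI exI[of _ "e / (1 + e)"]) auto
        then show ?thesis
          using F \<open>z \<in> S\<close> yS xF unfolding face_of_def by blast
      qed (use xF in simp)
    qed
  qed
  moreover have "?I exposed_face_of S"
  proof (rule exposed_face_of_Inter)
    have "q x (\<lambda>_. 0) = 0" by (simp add: q_def)
    then show "(\<lambda>v. {y \<in> S. q y v = 0}) ` {v. q x v = 0} \<noteq> {}" by blast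
  qed (use exp in blast)
  ultimately show ?thesis by simp
qed

section \<open>Non-exposed faces of the Grassmann orbitope and coorbitope\<close>

theorem theorem7p6:
  shows "(\<exists>x. x extreme_point_of polar grassmann_orbitope \<and>
              \<not> {x} exposed_face_of polar grassmann_orbitope) \<and>
         (\<exists>E. E edge_of grassmann_orbitope \<and> \<not> E exposed_face_of grassmann_orbitope) \<and>
         \<not> spectrahedron grassmann_orbitope \<and>
         \<not> spectrahedron (polar grassmann_orbitope)"
proof (intro conjI)
  show "\<exists>x. x extreme_point_of polar grassmann_orbitope \<and> \<not> {x} exposed_face_of polar grassmann_orbitope"
    using degenerate_form_extreme degenerate_form_not_exposed by blast
  show "\<exists>E. E edge_of grassmann_orbitope \<and> \<not> E exposed_face_of grassmann_orbitope"
    using sl_edge_edge_of sl_edge_not_exposed by blast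
  show "\<not> spectrahedron grassmann_orbitope"
    using spectrahedron_face_exposed sl_edge_edge_of sl_edge_not_exposed unfolding edge_of_def by blast
  show "\<not> spectrahedron (polar grassmann_orbitope)"
    using spectrahedron_face_exposed degenerate_form_extreme degenerate_form_not_exposed face_of_singleton by blast
qed

end
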